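(* Let $\Gamma$ and the data $s_0,\eta_0,\Xi$ be as in the context, and fix a closed ball $B\subset\mathbb R^{n-1}$. For any positive constants $A_1<A_2$ and $A_3$, there exist constants $T>0$, $h_0>0$ and $\Upsilon>0$ such that for every $t\ge T$ and every $\gamma\in\Gamma$ with $\gamma\notin P$, $\gamma\infty\in B$ and $h(\gamma\infty)\ge h_0$, the number of cusp points of the form $\gamma'\infty$ ($\gamma'\in\Gamma$) such that $h(\gamma'\infty)\in[A_1e^th(\gamma\infty),A_2e^th(\gamma\infty)]$ and $\|\gamma'\infty-\gamma\infty\|\le A_3/h(\gamma\infty)$ is at least $\Upsilon e^{(n-1)t}$.
   Context: Let $n\ge2$, $G=\mathrm{SO}(n,1)$, $K\cong\mathrm{SO}(n)$ maximal compact. $A=\{a(t)\}$ is a one-parameter $\mathbb R$-split torus with $\mathfrak g=\mathfrak g_{-1}\oplus\mathfrak z(A)\oplus\mathfrak g_{+1}$, $\mathrm{Ad}(a(t))=e^{\pm t}$ on $\mathfrak g_{\pm1}$; $M=Z_G(A)\cap K$, $N=\exp\mathfrak g_{+1}$, $\mathfrak g_{+1}\cong\mathbb R^{n-1}$ with an $\mathrm{Ad}(M)$-invariant Euclidean norm $\|\cdot\|$, $u(\mathbf x)=\exp(\mathbf x)$. $\sigma\in K$ with $\sigma^2=e$, $\sigma a(t)\sigma^{-1}=a(-t)$; $P=MAN$. Every $g\in G\setminus P$ can be written $g=u(\mathbf x)\sigma m a(r)u(\mathbf y)$ ($m\in M$), with $\mathbf x,r$ uniquely determined; $\partial\mathbb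 H^n=G/P\cong\mathbb R^{n-1}\cup\{\infty\}$ via $u(\mathbf x)\sigma P\mapsto\mathbf x$, $P\mapsto\infty$, so $g\infty=\mathbf x$. For compact $\eta\subset N$, $s\in\mathbb R$: $A_s=\{a(t):t\ge s\}$, $\Omega(\eta,s)=\eta A_sK$. $\Gamma\subset G$ is discrete with $\Gamma\backslash G$ of finite volume and $\Gamma\backslash\mathbb H^n$ non-compact; fixed data $s_0>0$, compact $\eta_0\subset N$, finite $\Xi\subset G$ with $e\in\Xi$ satisfy: (i) $G=\Gamma\Xi\Omega(\eta_0,s_0)$; (ii) $\Gamma\cap\xi N\xi^{-1}$ is a cocompact lattice in $\xi N\xi^{-1}$ for each $\xi\in\Xi$; (iii) for each compact $\eta\subset N$, $\{\gamma\in\Gamma:\gamma\Xi\Omega(\eta,s_0)\cap\Omega(\eta,s_0)\ne\emptyset\}$ is finite; (iv) for each compact $\eta\supseteq\eta_0$ there is $s_1>s_0$ such that $\gamma\xi_1\Omega(\eta,s_0)\cap\xi_2\Omega(\eta,s_1)\ne\emptyset$ ($\gamma\in\Gamma,\xi_i\in\Xi$) implies $\xi_1=\xi_2$ and $\gamma\in\xi_1NM\xi_1^{-1}$. Cusps of $\Gamma$ are the points $\gamma\xi\infty$. Height: if $\gamma\xi\notin P$ and $\gamma\xi=u(\mathbf x_1)\sigma ma(r)u(\mathbf y)$, then $h(\gamma\xi\infty)=e^r$. *)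

theory Defs
  imports "HOL-Analysis.Analysis"
begin

text \<open>Concrete model of G = SO(n,1) (identity component) acting on R^(n+1),
 where n - 1 = CARD('m).  Coordinates of R^(n+1) are indexed by 'm option option:
 None = e_0, Some None = e_n, Some (Some i) = e_i (1 <= i <= n-1).
 Quadratic form Q(v) = 2 v_0 v_n - sum_i v_i^2 (signature (1,n)).
 The null line R e_0 is the boundary point infinity.\<close>

type_synonym 'm idx = "'m option option"
type_synonym 'm gmat = "real^('m idx)^('m idx)"

definition Jform :: "'m::finite gmat" where
  "Jform = (\<chi> r c. (case r of
       None \<Rightarrow> (if c = Some None then 1 else 0)
     | Some None \<Rightarrow> (if c = None then 1 else 0)
     | Some (Some i) \<Rightarrow> (if c = Some (Some i) then -1 else 0)))"

text \<open>base point o = e_0 + e_n of hyperbolic space (future timelike vector)\<close>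
definition obase :: "real^('m::finite idx)" where
  "obase = (\<chi> r. (case r of None \<Rightarrow> 1 | Some None \<Rightarrow> 1 | Some (Some i) \<Rightarrow> 0))"

text \<open>G = SO_0(n,1): preserves Q, determinant 1, preserves the future light cone.\<close>
definition Gset :: "'m::finite gmat set" where
  "Gset = {g. transpose g ** Jform ** g = Jform \<and> det g = 1 \<and>
              (g *v obase) $ None + (g *v obase) $ (Some None) > 0}"

text \<open>K = stabiliser of the base point, a maximal compact subgroup isomorphic to SO(n).\<close>
definition Kset :: "'m::finite gmat set" where
  "Kset = {k \<in> Gset. k *v obase = obase}"

text \<open>the one-parameter split torus a(t); Ad(a(t)) = e^t on the Lie algebra of N\<close>
definition atorus :: "real \<Rightarrow> 'm::finite gmat" where
  "atorus t = (\<chi> r c. if r = c then (case r of None \<Rightarrow> exp t | Some None \<Rightarrow> exp (- t)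
                                          | Some (Some i) \<Rightarrow> 1) else 0)"

text \<open>u(x) = exp(x), x in g_{+1} identified with R^(n-1) = real^'m (Euclidean norm)\<close>
definition umat :: "real^'m \<Rightarrow> 'm::finite gmat" where
  "umat x = (\<chi> r c. (case r of
       None \<Rightarrow> (case c of None \<Rightarrow> 1 | Some None \<Rightarrow> (norm x)^2 / 2 | Some (Some j) \<Rightarrow> x $ j)
     | Some None \<Rightarrow> (if c = Some None then 1 else 0)
     | Some (Some i) \<Rightarrow> (case c of None \<Rightarrow> 0 | Some None \<Rightarrow> x $ i
                                  | Some (Some j) \<Rightarrow> (if i = j then 1 else 0))))"

definition Nset :: "'m::finite gmat set" where
  "Nset = range umat"

definition Mset :: "'m::finite gmat set" where
  "Mset = {m \<in> Kset. \<forall>t. m ** atorus t = atorus t ** m}"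

definition Pset :: "'m::finite gmat set" where
  "Pset = {m ** atorus t ** umat x | m t x. m \<in> Mset}"

text \<open>sigma: swaps e_0 and e_n and negates one fixed coordinate e_{i0};
  sigma is in K, sigma^2 = 1 and sigma a(t) sigma^-1 = a(-t).\<close>
definition sigma_idx :: "'m" where "sigma_idx = (SOME i. True)"

definition sigma :: "'m::finite gmat" where
  "sigma = (\<chi> r c. (case r of
       None \<Rightarrow> (if c = Some None then 1 else 0)
     | Some None \<Rightarrow> (if c = None then 1 else 0)
     | Some (Some i) \<Rightarrow> (if c = Some (Some i) then (if i = sigma_idx then -1 else 1) else 0)))"

definition bruhat :: "'m::finite gmat \<Rightarrow> real^'m \<Rightarrow> real \<Rightarrow> bool" where
  "bruhat g x r \<longleftrightarrow> (\<exists>m \<in> Mset. \<exists>y. g = umat x ** sigma ** m ** atorus r ** umat y)"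

text \<open>g infinity in R^(n-1) (for g not in P)\<close>
definition bdry :: "'m::finite gmat \<Rightarrow> real^'m" where
  "bdry g = (THE x. \<exists>r. bruhat g x r)"

text \<open>height h(g infinity) = e^r (for g not in P)\<close>
definition height :: "'m::finite gmat \<Rightarrow> real" where
  "height g = exp (THE r. \<exists>x. bruhat g x r)"

definition Omega :: "'m::finite gmat set \<Rightarrow> real \<Rightarrow> 'm gmat set" where
  "Omega eta s = {v ** atorus t ** k | v t k. v \<in> eta \<and> s \<le> t \<and> k \<in> Kset}"

definition setmul :: "'m::finite gmat set \<Rightarrow> 'm gmat set \<Rightarrow> 'm gmat set" where
  "setmul X Y = {x ** y | x y. x \<in> X \<and> y \<in> Y}"

definition conjN :: "'m::finite gmat \<Rightarrow> 'm gmat set" where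
  "conjN \<xi> = {\<xi> ** v ** matrix_inv \<xi> | v. v \<in> Nset}"

definition conjNM :: "'m::finite gmat \<Rightarrow> 'm gmat set" where
  "conjNM \<xi> = {\<xi> ** v ** m ** matrix_inv \<xi> | v m. v \<in> Nset \<and> m \<in> Mset}"

definition is_subgroup :: "'m::finite gmat set \<Rightarrow> 'm gmat set \<Rightarrow> bool" where
  "is_subgroup H S \<longleftrightarrow> H \<subseteq> S \<and> mat 1 \<in> H \<and> (\<forall>x\<in>H. \<forall>y\<in>H. x ** y \<in> H)
      \<and> (\<forall>x\<in>H. matrix_inv x \<in> H)"

definition discrete_set :: "'m::finite gmat set \<Rightarrow> bool" where
  "discrete_set H \<longleftrightarrow> (\<forall>x\<in>H. \<exists>e>0. \<forall>y\<in>H. dist y x < e \<longrightarrow> y = x)"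

definition cocompact_lattice :: "'m::finite gmat set \<Rightarrow> 'm gmat set \<Rightarrow> bool" where
  "cocompact_lattice L S \<longleftrightarrow> is_subgroup L S \<and> discrete_set L \<and>
      (\<exists>C. compact C \<and> C \<subseteq> S \<and> S = setmul L C)"

end

theory Submission
  imports Defs
begin

text \<open>
  Let \<open>e\<close> (\<open>einf\<close> below) span the null line of the point at infinity. A cusp \<open>\<gamma>\<infinity>\<close> is recorded by the light-cone vector
  \<open>\<gamma>e\<close>: its last coordinate is the height and its projection is the boundary point, and the invariant
  form of two such vectors is half the product of the heights times the squared distance. Hence, if
  \<open>\<gamma>\<infinity>\<close> has height \<open>h\<close> and \<open>z\<close> is a cusp of height \<open>c\<close> at distance \<open>d\<close> from \<open>\<gamma>\<^sup>-\<^sup>1\<infinity>\<close>, then \<open>\<gamma>z\<close> has height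
  \<open>c h d\<^sup>2 / 2\<close> and distance \<open>2 / (h d)\<close> from \<open>\<gamma>\<infinity>\<close>.

  Applying the covering (i) to \<open>u(x) a(-t)\<close> gives Dirichlet's theorem: with \<open>H = e\<^sup>t\<close>, every bounded \<open>x\<close> is within
  \<open>r = 2 / sqrt (h H)\<close> of a cusp \<open>\<gamma>\<xi>\<infinity>\<close> of some height \<open>h \<le> H\<close>. By (ii) the stabiliser of that cusp produces at
  least \<open>(r H)\<^sup>n\<^sup>-\<^sup>1\<close> points of the single orbit \<open>\<Gamma>\<infinity>\<close> of height \<open>O(H)\<close> in the ball of radius \<open>r\<close> about it, so a
  Vitali covering yields a multiple of \<open>H\<^sup>n\<^sup>-\<^sup>1\<close> such points in a fixed small ball. Finally, translating them by
  the lattice at infinity tunes \<open>d\<close>, hence the height of the image under \<open>\<gamma>\<close>, into an arbitrary window.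
\<close>

section \<open>Coordinates and the invariant form\<close>

text \<open>Coefficient at e_0, middle part and coefficient at e_n. Matrices are handled below
  through their action on such triples.\<close>

definition lvec :: "real \<Rightarrow> real^'m \<Rightarrow> real \<Rightarrow> real^('m::finite idx)" where
  "lvec a x b = (\<chi> r. case r of None \<Rightarrow> a | Some None \<Rightarrow> b | Some (Some i) \<Rightarrow> x $ i)"

definition mid :: "real^('m::finite idx) \<Rightarrow> real^'m" where
  "mid v = (\<chi> i. v $ Some (Some i))"

lemma lvec_simps [simp]: "lvec a x b $ None = a" "lvec a x b $ Some None = b"
  "lvec a x b $ Some (Some i) = x $ i" "mid (lvec a x b) = x"
  by (simp_all add: lvec_def mid_def vec_eq_iff)

lemma vec_eq_parts: "v = w \<longleftrightarrow> v $ None = w $ None \<and> v $ Some None = w $ Some None \<and> mid v = mid w"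
  unfolding vec_eq_iff mid_def by (auto simp: split_option_all)

lemma mid_linear [simp]: "mid (v + w) = mid v + mid w" "mid (v - w) = mid v - mid w"
  "mid (a *\<^sub>R v) = a *\<^sub>R mid v" "mid (- v) = - mid v" "mid 0 = 0"
  by (simp_all add: mid_def vec_eq_iff)

lemma sum_UNIV_option: "(\<Sum>x\<in>UNIV. f x) = f None + (\<Sum>x\<in>UNIV. f (Some x))"
  for f :: "'a::finite option \<Rightarrow> 'b::comm_monoid_add"
  by (simp add: UNIV_option_conv sum.reindex)

lemma inner_parts: "v \<bullet> w = v $ None * w $ None + v $ Some None * w $ Some None + mid v \<bullet> mid w"
  for v w :: "real^('m::finite idx)"
  by (simp add: inner_vec_def sum_UNIV_option mid_def)

text \<open>The symmetric bilinear form with \<open>bf v v\<close> = Q(v); its Gram matrix is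
  \<open>Jform\<close>.\<close>

definition bf :: "real^('m::finite idx) \<Rightarrow> real^('m idx) \<Rightarrow> real" where
  "bf v w = v $ None * w $ Some None + v $ Some None * w $ None - mid v \<bullet> mid w"

lemma bf_commute: "bf v w = bf w v"
  by (simp add: bf_def inner_commute)

lemma bf_linear: "bf (v + v') w = bf v w + bf v' w" "bf (v - v') w = bf v w - bf v' w"
  "bf (a *\<^sub>R v) w = a * bf v w" "bf (- v) w = - bf v w"
  "bf v (w + w') = bf v w + bf v w'" "bf v (w - w') = bf v w - bf v w'"
  "bf v (a *\<^sub>R w) = a * bf v w" "bf v (- w) = - bf v w"
  by (simp_all add: bf_def algebra_simps inner_add_left inner_add_right inner_diff_left inner_diff_right)

lemma Jform_vec: "Jform *v v = lvec (v $ Some None) (- mid v) (v $ None)"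
  unfolding vec_eq_parts
  by (auto simp: Jform_def matrix_vector_mult_def mid_def vec_eq_iff sum_UNIV_option if_distrib[where f="\<lambda>x. x * _"]
      sum.delta' cong: if_cong)

lemma bf_Jform: "bf v w = v \<bullet> (Jform *v w)"
  by (simp add: Jform_vec inner_parts bf_def)

section \<open>Isometries of the form and their determinants\<close>

definition preserves_bf :: "'m::finite gmat \<Rightarrow> bool" where
  "preserves_bf g \<longleftrightarrow> (\<forall>v w. bf (g *v v) (g *v w) = bf v w)"

lemma preserves_bfD: "preserves_bf g \<Longrightarrow> bf (g *v v) (g *v w) = bf v w"
  by (simp add: preserves_bf_def)

lemma bf_matrix: "bf (g *v v) (g *v w) = v \<bullet> ((transpose g ** Jform ** g) *v w)"
proof -
  have "bf (g *v v) (g *v w) = (v v* transpose g) \<bullet> (Jform *v (g *v w))"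
    by (simp add: bf_Jform vector_transpose_matrix)
  also have "\<dots> = v \<bullet> (transpose g *v (Jform *v (g *v w)))"
    by (rule dot_lmul_matrix)
  finally show ?thesis by (metis matrix_vector_mul_assoc)
qed

lemma preserves_bf_iff: "preserves_bf g \<longleftrightarrow> transpose g ** Jform ** g = Jform"
proof
  assume "preserves_bf g"
  then have "v \<bullet> ((transpose g ** Jform ** g) *v w) = v \<bullet> (Jform *v w)" for v w
    by (metis bf_Jform bf_matrix preserves_bf_def)
  then show "transpose g ** Jform ** g = Jform"
    unfolding matrix_eq by (metis vector_eq_ldot)
next
  assume "transpose g ** Jform ** g = Jform"
  then show "preserves_bf g" by (simp only: preserves_bf_def bf_matrix) (simp add: bf_Jform)
qed

lemma preserves_bf_det: assumes "preserves_bf g" shows "det g * det g = 1"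
proof -
  have "(Jform :: 'a gmat) ** Jform = mat 1"
    unfolding matrix_eq by (simp add: matrix_vector_mul_assoc [symmetric] Jform_vec vec_eq_parts)
  then have "det (Jform :: 'a gmat) \<noteq> 0" by (metis det_I det_mul mult_zero_left zero_neq_one)
  moreover have "det g * det (Jform :: 'a gmat) * det g = det (Jform :: 'a gmat)"
    by (metis assms det_mul det_transpose preserves_bf_iff)
  ultimately show ?thesis by (simp add: mult.commute)
qed

text \<open>An isometry has determinant 1 or -1, and a square has nonnegative determinant. This
  settles u(x) and a(t), which have square roots in their own groups.\<close>

lemma preserves_bf_square_det: assumes "preserves_bf g" "g = s ** s" shows "det g = 1"
proof -
  have "det g \<ge> 0" using assms(2) by (simp add: det_mul)
  then show ?thesis using preserves_bf_det[OF assms(1)]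
    by (metis abs_of_nonneg power2_eq_1_iff power2_eq_square abs_1 abs_minus_cancel)
qed

section \<open>The groups N and A and the element sigma in coordinates\<close>

lemma umat_vec: "umat x *v v = lvec (v $ None + norm x ^ 2 / 2 * v $ Some None + x \<bullet> mid v)
    (mid v + v $ Some None *\<^sub>R x) (v $ Some None)"
  unfolding vec_eq_parts
  by (auto simp: umat_def matrix_vector_mult_def mid_def vec_eq_iff sum_UNIV_option if_distrib[where f="\<lambda>x. x * _"]
      if_distrib[where f="\<lambda>x. _ * x"] inner_vec_def sum.delta' mult.commute cong: if_cong)

lemma atorus_vec: "atorus t *v v = lvec (exp t * v $ None) (mid v) (exp (- t) * v $ Some None)"
  unfolding vec_eq_parts
  by (auto simp: atorus_def matrix_vector_mult_def mid_def vec_eq_iff sum_UNIV_option if_distrib[where f="\<lambda>x. x * _"]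
       sum.delta' cong: if_cong)

definition flip :: "real^'m::finite \<Rightarrow> real^'m" where
  "flip x = (\<chi> i. if i = sigma_idx then - x $ i else x $ i)"

lemma flip_simps [simp]: "flip (flip x) = x" "flip x \<bullet> flip y = x \<bullet> y"
  by (auto simp: flip_def vec_eq_iff inner_vec_def intro!: sum.cong)

lemma sigma_vec: "sigma *v v = lvec (v $ Some None) (flip (mid v)) (v $ None)"
  unfolding vec_eq_parts
  by (auto simp: sigma_def flip_def matrix_vector_mult_def mid_def vec_eq_iff sum_UNIV_option if_distrib[where f="\<lambda>x. x * _"]
       sum.delta' cong: if_cong)

lemma umat_preserves: "preserves_bf (umat x)"
  by (simp add: preserves_bf_def umat_vec bf_def algebra_simps inner_add_left inner_add_right inner_commute
      power2_norm_eq_inner)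

lemma atorus_preserves: "preserves_bf (atorus t)"
  by (simp add: preserves_bf_def atorus_vec bf_def exp_minus field_simps)

lemma sigma_preserves: "preserves_bf sigma"
  by (simp add: preserves_bf_def sigma_vec bf_def)

lemma umat_add: "umat x ** umat y = umat (x + y)"
  unfolding matrix_eq
  by (simp add: matrix_vector_mul_assoc [symmetric] umat_vec vec_eq_parts algebra_simps inner_add_left inner_add_right
      power2_norm_eq_inner inner_commute add_divide_distrib)

lemma umat_0: "umat 0 = mat 1"
  unfolding matrix_eq by (simp add: umat_vec vec_eq_parts)

lemma atorus_add: "atorus s ** atorus t = atorus (s + t)"
  unfolding matrix_eq
  by (simp add: matrix_vector_mul_assoc [symmetric] atorus_vec vec_eq_parts exp_add exp_minus exp_diff field_simps)

lemma atorus_0: "atorus 0 = mat 1"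
  unfolding matrix_eq by (simp add: atorus_vec vec_eq_parts)

lemma sigma_sigma: "sigma ** sigma = mat 1"
  unfolding matrix_eq
  by (simp add: matrix_vector_mul_assoc [symmetric] sigma_vec vec_eq_parts)

lemma det_umat: "det (umat x) = 1"
  by (rule preserves_bf_square_det[OF umat_preserves, of _ "umat (x /\<^sub>R 2)"])
     (simp add: umat_add scaleR_add_left [symmetric])

lemma det_atorus: "det (atorus t) = 1"
  by (rule preserves_bf_square_det[OF atorus_preserves, of _ "atorus (t / 2)"])
     (simp add: atorus_add)

text \<open>A transposition of two columns turns \<open>sigma\<close> into a diagonal matrix with a
  single entry -1; the two signs cancel.\<close>

lemma det_sigma: "det (sigma :: 'm::finite gmat) = 1"
proof -
  define p :: "'m idx \<Rightarrow> 'm idx" where "p = Fun.swap None (Some None) id"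
  define D :: "'m gmat" where "D = (\<chi> i j. if i = j then (if i = Some (Some sigma_idx) then -1 else 1) else 0)"
  have p: "p permutes UNIV" unfolding p_def by (simp add: permutes_swap_id)
  have "sigma = (\<chi> i j. D $ i $ p j)"
    by (auto simp: vec_eq_iff sigma_def D_def p_def Fun.swap_def transpose_def split: option.splits)
  then have "det (sigma :: 'm gmat) = of_int (sign p) * det D"
    using det_permute_columns[OF p, of D] by simp
  moreover have "sign p = -1" unfolding p_def by (simp add: sign_swap_id)
  moreover have "det D = (\<Prod>i\<in>UNIV. D $ i $ i)"
    by (rule det_diagonal) (simp add: D_def)
  moreover have "(\<Prod>i\<in>UNIV. D $ i $ i) = -1"
    by (simp add: D_def prod.delta)
  ultimately show ?thesis by simp
qed

section \<open>The light cone and the Bruhat decomposition\<close>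

abbreviation einf :: "real^('m::finite idx)" where "einf \<equiv> lvec 1 0 0"

text \<open>The future cone without its apex. Its rays are the boundary points, the ray of
  \<open>einf\<close> being the point at infinity.\<close>

definition lightcone :: "(real^('m::finite idx)) set" where
  "lightcone = {v. bf v v = 0 \<and> v $ None + v $ Some None > 0}"

text \<open>Junk value \<open>0\<close> on the line of \<open>einf\<close>, where the boundary point is \<open>\<infinity>\<close>.\<close>

definition pos :: "real^('m::finite idx) \<Rightarrow> real^'m" where
  "pos v = mid v /\<^sub>R (v $ Some None)"

lemma umat_einf [simp]: "umat x *v einf = einf"
  by (simp add: umat_vec vec_eq_parts)

lemma atorus_einf [simp]: "atorus t *v einf = exp t *\<^sub>R einf"
  by (simp add: atorus_vec vec_eq_parts)

lemma obase_lvec: "obase = lvec 1 0 1"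
  unfolding vec_eq_parts by (simp add: obase_def mid_def vec_eq_iff)

text \<open>The product of the two null coordinates is at least half the squared length of the
  middle part, so they cannot have opposite signs.\<close>

lemma future_nonneg:
  assumes "bf v v \<ge> 0" "v $ None + v $ Some None > 0"
  shows "v $ None \<ge> 0" "v $ Some None \<ge> 0"
proof -
  have "mid v \<bullet> mid v \<le> 2 * (v $ None * v $ Some None)"
    using assms(1) by (simp add: bf_def)
  then have *: "v $ None * v $ Some None \<ge> 0"
    using inner_ge_zero[of "mid v"] by linarith
  show "v $ None \<ge> 0" "v $ Some None \<ge> 0"
    using * assms(2) by (auto simp: zero_le_mult_iff)
qed

text \<open>Cauchy-Schwarz for the middle parts, followed by 4pq \<le> (p + q)^2 for the two mixed
  products of null coordinates.\<close>

lemma bf_future_nonneg: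
  assumes v: "bf v v \<ge> 0" "v $ None \<ge> 0" "v $ Some None \<ge> 0"
    and w: "bf w w \<ge> 0" "w $ None \<ge> 0" "w $ Some None \<ge> 0"
  shows "bf v w \<ge> 0"
proof -
  define p where "p = v $ None * w $ Some None"
  define q where "q = v $ Some None * w $ None"
  have pq: "p \<ge> 0" "q \<ge> 0" using v w by (simp_all add: p_def q_def)
  have "(mid v \<bullet> mid w)\<^sup>2 \<le> (mid v \<bullet> mid v) * (mid w \<bullet> mid w)"
    by (rule Cauchy_Schwarz_ineq)
  also have "\<dots> \<le> (2 * (v $ None * v $ Some None)) * (2 * (w $ None * w $ Some None))"
    using v w by (intro mult_mono) (auto simp: bf_def)
  also have "\<dots> = 4 * (p * q)" by (simp add: p_def q_def)
  also have "\<dots> \<le> (p + q)\<^sup>2"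
    using zero_le_power2[of "p - q"] by (simp add: power2_eq_square algebra_simps)
  finally have "mid v \<bullet> mid w \<le> p + q"
    using pq by (meson add_nonneg_nonneg power2_le_imp_le)
  then show ?thesis by (simp add: bf_def p_def q_def)
qed

lemma einf_lightcone [simp]: "einf \<in> lightcone"
  by (simp add: lightcone_def bf_def)

lemma lightconeD:
  assumes "v \<in> lightcone"
  shows "bf v v = 0" "v $ None \<ge> 0" "v $ Some None \<ge> 0" "v $ None + v $ Some None > 0"
  using assms future_nonneg[of v] by (auto simp: lightcone_def)

text \<open>Off the ray at infinity the cone is a paraboloid: v is its last coordinate times (|x|^2
  / 2, x, 1), where x is \<open>pos v\<close>.\<close>

lemma lightcone_parts:
  assumes "v \<in> lightcone" "v $ Some None > 0"
  shows "v $ None = v $ Some None * norm (pos v) ^ 2 / 2" "mid v = v $ Some None *\<^sub>R pos v"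
proof -
  have eq: "mid v \<bullet> mid v = 2 * (v $ None * v $ Some None)"
    using lightconeD(1)[OF assms(1)] by (simp add: bf_def)
  have "norm (pos v) ^ 2 = (mid v \<bullet> mid v) / (v $ Some None) ^ 2"
    unfolding power2_norm_eq_inner by (simp add: pos_def power2_eq_square field_simps)
  then show "v $ None = v $ Some None * norm (pos v) ^ 2 / 2"
    using assms(2) by (simp add: eq power2_eq_square)
  show "mid v = v $ Some None *\<^sub>R pos v"
    using assms(2) by (simp add: pos_def)
qed

lemma lightcone_at_infinity:
  assumes "v \<in> lightcone" "v $ Some None = 0"
  shows "v = v $ None *\<^sub>R einf" "v $ None > 0"
proof -
  have "mid v = 0"
    using lightconeD(1)[OF assms(1)] assms(2) by (simp add: bf_def)
  then show "v = v $ None *\<^sub>R einf" using assms(2) by (simp add: vec_eq_parts)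
  show "v $ None > 0" using lightconeD(4)[OF assms(1)] assms(2) by simp
qed

text \<open>In paraboloid coordinates the form is |x|^2 / 2 + |y|^2 / 2 minus the inner product of x
  and y, up to the two heights: a completed square.\<close>

lemma bf_lightcone:
  assumes "v \<in> lightcone" "v $ Some None > 0" "w \<in> lightcone" "w $ Some None > 0"
  shows "bf v w = v $ Some None * w $ Some None * norm (pos v - pos w) ^ 2 / 2"
  by (simp add: bf_def lightcone_parts[OF assms(1,2)] lightcone_parts[OF assms(3,4)]
      power2_norm_eq_inner inner_diff_left inner_diff_right inner_commute field_simps)

lemma bf_einf [simp]: "bf v einf = v $ Some None" "bf einf v = v $ Some None"
  by (simp_all add: bf_def)

lemma lightcone_orthogonal_einf:
  assumes "v \<in> lightcone" "bf v einf = 0"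
  shows "v = v $ None *\<^sub>R einf" "v $ None > 0"
  using lightcone_at_infinity[OF assms(1)] assms(2) by simp_all

lemma Gset_preserves: "g \<in> Gset \<Longrightarrow> preserves_bf g"
  by (simp add: Gset_def preserves_bf_iff)

lemma Gset_iff: "g \<in> Gset \<longleftrightarrow> preserves_bf g \<and> det g = 1 \<and> bf (g *v obase) obase > 0"
  by (simp add: Gset_def preserves_bf_iff bf_def obase_lvec add.commute)

text \<open>The image w of v is null and pairs positively with the image q of the base point. If w
  pointed to the past, \<open>bf_future_nonneg\<close> for - w and q would give the opposite
  sign.\<close>

lemma lightcone_Gset:
  assumes "g \<in> Gset" "v \<in> lightcone"
  shows "g *v v \<in> lightcone"
proof -
  note P = preserves_bfD[OF Gset_preserves[OF assms(1)]]
  define q where "q = g *v obase"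
  define w where "w = g *v v"
  have q: "bf q q \<ge> 0" "q $ None + q $ Some None > 0"
    using assms(1) P[of obase obase] by (auto simp: q_def Gset_def) (simp add: obase_lvec bf_def)
  have ww: "bf w w = 0" using lightconeD[OF assms(2)] by (simp add: w_def P)
  have "bf w q = v $ None + v $ Some None"
    unfolding w_def q_def P by (simp add: obase_lvec bf_def)
  then have wq: "bf w q > 0" using lightconeD[OF assms(2)] by simp
  have "w $ None + w $ Some None > 0"
  proof (rule ccontr)
    assume "\<not> ?thesis"
    then have n: "w $ None + w $ Some None \<le> 0" by simp
    have "2 * (w $ None * w $ Some None) = mid w \<bullet> mid w" using ww by (simp add: bf_def)
    then have "w $ None * w $ Some None \<ge> 0" using inner_ge_zero[of "mid w"] by linarith
    then have "(- w) $ None \<ge> 0" "(- w) $ Some None \<ge> 0"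
      using n by (auto simp: zero_le_mult_iff)
    moreover have "bf (- w) (- w) \<ge> 0" using ww by (simp add: bf_linear)
    ultimately have "bf (- w) q \<ge> 0"
      using bf_future_nonneg[of "- w" q] q future_nonneg[OF q] by blast
    then show False using wq by (simp add: bf_linear)
  qed
  then show ?thesis using ww by (simp add: lightcone_def w_def)
qed

lemma preserves_bf_inv:
  assumes "preserves_bf g"
  shows "matrix_inv g ** g = mat 1" "g ** matrix_inv g = mat 1"
proof -
  have "det g \<noteq> 0" using preserves_bf_det[OF assms] by auto
  then have "invertible g" by (simp add: invertible_det_nz)
  then have "g ** matrix_inv g = mat 1 \<and> matrix_inv g ** g = mat 1"
    unfolding invertible_def matrix_inv_def by (rule someI_ex)
  then show "matrix_inv g ** g = mat 1" "g ** matrix_inv g = mat 1" by simp_all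
qed

lemma preserves_bf_inv_vec:
  assumes "preserves_bf g"
  shows "matrix_inv g *v (g *v v) = v" "g *v (matrix_inv g *v v) = v"
  by (simp_all add: matrix_vector_mul_assoc preserves_bf_inv[OF assms])

lemma bf_inv: "preserves_bf g \<Longrightarrow> bf (matrix_inv g *v v) w = bf v (g *v w)"
  by (metis preserves_bf_def preserves_bf_inv_vec(2))

lemma Gset_inv:
  assumes "g \<in> Gset"
  shows "matrix_inv g \<in> Gset"
proof -
  have P: "preserves_bf g" by (rule Gset_preserves[OF assms])
  have "preserves_bf (matrix_inv g)"
    using P by (simp add: preserves_bf_def bf_inv preserves_bf_inv_vec[OF P])
  moreover have "det (matrix_inv g) = 1"
    using assms arg_cong[OF preserves_bf_inv(2)[OF P], of det] by (simp add: det_mul Gset_iff)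
  ultimately show ?thesis
    using assms by (simp add: Gset_iff bf_inv[OF P]) (simp add: bf_commute)
qed

lemma preserves_bf_mult: "preserves_bf g \<Longrightarrow> preserves_bf h \<Longrightarrow> preserves_bf (g ** h)"
  by (simp add: preserves_bf_def matrix_vector_mul_assoc [symmetric])

lemma umat_Gset: "umat x \<in> Gset"
  by (simp add: Gset_iff umat_preserves det_umat umat_vec obase_lvec bf_def add_pos_nonneg)

lemma umat_atorus_Gset: "umat x ** atorus t \<in> Gset"
  by (simp add: Gset_iff umat_preserves atorus_preserves preserves_bf_mult det_umat det_atorus det_mul
      matrix_vector_mul_assoc [symmetric] umat_vec atorus_vec obase_lvec bf_def add_pos_nonneg)

text \<open>Commuting with a(1) makes the image an eigenvector for the eigenvalue e, hence a
  multiple of \<open>einf\<close>; fixing the base point makes the factor 1.\<close>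

lemma Mset_einf:
  assumes "m \<in> Mset"
  shows "m *v einf = einf"
proof -
  have m: "m \<in> Gset" "m *v obase = obase" "m ** atorus 1 = atorus 1 ** m"
    using assms by (auto simp: Mset_def Kset_def)
  define w where "w = m *v einf"
  have "atorus 1 *v w = m *v (atorus 1 *v einf)"
    by (simp only: w_def matrix_vector_mul_assoc m(3))
  also have "atorus 1 *v einf = exp 1 *\<^sub>R einf" by simp
  also have "m *v (exp 1 *\<^sub>R einf) = exp 1 *\<^sub>R w"
    by (simp add: w_def matrix_vector_mult_scaleR)
  finally have *: "atorus 1 *v w = exp 1 *\<^sub>R w" .
  have "exp (- 1) * w $ Some None = exp 1 * w $ Some None"
    using arg_cong[OF *, of "\<lambda>v. v $ Some None"] by (simp add: atorus_vec)
  then have n: "w $ Some None = 0" by simp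
  have "mid w = exp 1 *\<^sub>R mid w"
    using arg_cong[OF *, of mid] by (simp add: atorus_vec)
  then have "(exp 1 - 1 :: real) *\<^sub>R mid w = 0" by (simp add: scaleR_diff_left)
  then have z: "mid w = 0" by simp
  have "bf w obase = 1"
    unfolding w_def using preserves_bfD[OF Gset_preserves[OF m(1)], of einf obase]
    by (simp only: m(2)) (simp add: obase_lvec)
  then have "w $ None = 1" using n by (simp add: bf_def obase_lvec)
  then show ?thesis using n z by (simp add: w_def [symmetric] vec_eq_parts)
qed

text \<open>Such an m also preserves the orthogonal complement of the two null vectors, which is the
  middle space; the torus is the identity there, so m commutes with it.\<close>

lemma Mset_intro:
  assumes P: "preserves_bf m" and d: "det m = 1"
    and e: "m *v einf = einf" "m *v lvec 0 0 1 = lvec 0 0 1"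
  shows "m \<in> Mset"
proof -
  have split: "m *v v = lvec (v $ None) (mid (m *v lvec 0 (mid v) 0)) (v $ Some None)" for v
  proof -
    let ?z = "lvec 0 (mid v) 0"
    have "bf (m *v ?z) einf = bf ?z einf" using preserves_bfD[OF P, of ?z einf] e by simp
    moreover have "bf (m *v ?z) (lvec 0 0 1) = bf ?z (lvec 0 0 1)"
      using preserves_bfD[OF P, of ?z "lvec 0 0 1"] e by simp
    ultimately have z: "m *v ?z = lvec 0 (mid (m *v ?z)) 0"
      by (simp add: bf_def vec_eq_parts)
    have "v = v $ None *\<^sub>R einf + v $ Some None *\<^sub>R lvec 0 0 1 + ?z" by (simp add: vec_eq_parts)
    then have "m *v v = m *v (v $ None *\<^sub>R einf + v $ Some None *\<^sub>R lvec 0 0 1 + ?z)" by (rule arg_cong)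
    then have "m *v v = v $ None *\<^sub>R einf + v $ Some None *\<^sub>R lvec 0 0 1 + m *v ?z"
      by (simp only: matrix_vector_right_distrib matrix_vector_mult_scaleR e)
    with z show ?thesis by (simp add: vec_eq_parts)
  qed
  have o: "m *v obase = obase"
  proof -
    have "obase = einf + lvec 0 0 1" by (simp add: obase_lvec vec_eq_parts)
    then show ?thesis by (metis e matrix_vector_right_distrib)
  qed
  have "m ** atorus t = atorus t ** m" for t
    unfolding matrix_eq matrix_vector_mul_assoc [symmetric]
  proof
    fix v
    show "m *v (atorus t *v v) = atorus t *v (m *v v)"
      by (subst split, subst (2) split) (simp add: atorus_vec)
  qed
  moreover have "m \<in> Gset" using P d by (simp add: Gset_iff o) (simp add: obase_lvec bf_def)
  ultimately show ?thesis using o by (simp add: Mset_def Kset_def)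
qed

text \<open>The preimage w of e_n under g is null with last coordinate exp t, so it is exp t times
  the image of e_n under u(x) for a suitable x. Then g u(x) a(-t) fixes both null vectors and lies
  in M.\<close>

lemma parabolic_decomp:
  assumes P: "preserves_bf g" and d: "det g = 1" and e: "g *v einf = exp t *\<^sub>R einf"
  obtains m x where "m \<in> Mset" "g = m ** atorus t ** umat x"
proof -
  define w where "w = matrix_inv g *v lvec 0 0 1"
  have wn: "w $ Some None = exp t"
    using bf_inv[OF P, of "lvec 0 0 1" einf] by (simp add: w_def e bf_linear)
  have "bf w w = 0"
    by (simp add: w_def bf_inv[OF P] preserves_bf_inv_vec[OF P]) (simp add: bf_def)
  then have w0: "2 * (w $ None * exp t) = mid w \<bullet> mid w" by (simp add: bf_def wn mult.commute)
  define x where "x = mid w /\<^sub>R exp t"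
  have uw: "umat x *v lvec 0 0 (exp t) = w"
  proof -
    have "norm x ^ 2 = (mid w \<bullet> mid w) / exp t ^ 2"
      unfolding power2_norm_eq_inner by (simp add: x_def power2_eq_square field_simps)
    then show ?thesis
      by (simp add: umat_vec vec_eq_parts wn w0 [symmetric] power2_eq_square) (simp add: x_def)
  qed
  define m where "m = g ** umat x ** atorus (- t)"
  have "m \<in> Mset"
  proof (rule Mset_intro)
    show "preserves_bf m" unfolding m_def
      by (intro preserves_bf_mult P umat_preserves atorus_preserves)
    show "det m = 1" by (simp add: m_def det_mul d det_umat det_atorus)
    show "m *v einf = einf"
      by (simp add: m_def matrix_vector_mul_assoc [symmetric] matrix_vector_mult_scaleR e exp_minus)
    have "m *v lvec 0 0 1 = g *v (umat x *v (lvec 0 0 (exp t)))"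
      by (simp add: m_def matrix_vector_mul_assoc [symmetric] atorus_vec)
    also have "\<dots> = lvec 0 0 1" unfolding uw by (simp add: w_def preserves_bf_inv_vec[OF P])
    finally show "m *v lvec 0 0 1 = lvec 0 0 1" .
  qed
  moreover have "g = m ** atorus t ** umat (- x)"
  proof -
    have "m ** atorus t ** umat (- x) = g ** umat x ** (atorus (- t) ** atorus t) ** umat (- x)"
      by (simp add: m_def matrix_mul_assoc)
    also have "\<dots> = g ** (umat x ** umat (- x))"
      by (simp add: atorus_add atorus_0 matrix_mul_assoc)
    finally show ?thesis by (simp add: umat_add umat_0)
  qed
  ultimately show thesis using that by blast
qed

section \<open>The parabolic subgroup, heights and boundary points\<close>

lemma Pset_einf:
  assumes "g \<in> Pset"
  shows "(g *v einf) $ Some None = 0"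
proof -
  obtain m t x where g: "g = m ** atorus t ** umat x" "m \<in> Mset"
    using assms by (auto simp: Pset_def)
  have "g *v einf = exp t *\<^sub>R einf"
    by (simp add: g matrix_vector_mul_assoc [symmetric] matrix_vector_mult_scaleR Mset_einf)
  then show ?thesis by simp
qed

text \<open>P is the stabiliser in G of the ray of \<open>einf\<close>; the stretching factor on
  that ray gives the torus part.\<close>

lemma Pset_iff:
  assumes "g \<in> Gset"
  shows "g \<in> Pset \<longleftrightarrow> (g *v einf) $ Some None = 0"
proof
  assume 0: "(g *v einf) $ Some None = 0"
  have l: "g *v einf \<in> lightcone" by (rule lightcone_Gset[OF assms einf_lightcone])
  have "g *v einf = exp (ln ((g *v einf) $ None)) *\<^sub>R einf"
    using lightcone_at_infinity[OF l 0] by simp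
  moreover have "preserves_bf g" "det g = 1" using assms by (simp_all add: Gset_iff)
  ultimately obtain m x where "m \<in> Mset" "g = m ** atorus (ln ((g *v einf) $ None)) ** umat x"
    using parabolic_decomp by blast
  then show "g \<in> Pset" unfolding Pset_def by blast
qed (rule Pset_einf)

text \<open>The factors to the right of \<open>sigma\<close> only rescale \<open>einf\<close>, then
  \<open>sigma\<close> carries it to e_n and u(x) places it over x. This yields the uniqueness of x
  and r.\<close>

lemma bruhat_einf:
  assumes "bruhat g x r"
  shows "(g *v einf) $ Some None = exp r" "pos (g *v einf) = x"
proof -
  obtain m y where g: "g = umat x ** sigma ** m ** atorus r ** umat y" "m \<in> Mset"
    using assms by (auto simp: bruhat_def)
  have "g *v einf = exp r *\<^sub>R (umat x *v (sigma *v einf))"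
    by (simp add: g matrix_vector_mul_assoc [symmetric] matrix_vector_mult_scaleR Mset_einf)
  moreover have "flip 0 = (0 :: real^'a)" by (simp add: flip_def vec_eq_iff)
  ultimately show "(g *v einf) $ Some None = exp r" "pos (g *v einf) = x"
    by (simp_all add: pos_def umat_vec sigma_vec)
qed

text \<open>Moving the boundary point of g to 0 by u(-x) and then to infinity by
  \<open>sigma\<close> leaves an element to which \<open>parabolic_decomp\<close> applies.\<close>

lemma bruhat_exists:
  assumes g: "g \<in> Gset" and h: "(g *v einf) $ Some None > 0"
  shows "bruhat g (pos (g *v einf)) (ln ((g *v einf) $ Some None))"
proof -
  define v where "v = g *v einf"
  define x where "x = pos v"
  define g1 where "g1 = sigma ** umat (- x) ** g"
  have v: "v \<in> lightcone" unfolding v_def by (rule lightcone_Gset[OF g einf_lightcone])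
  have h': "v $ Some None > 0" using h by (simp add: v_def)
  have "umat (- x) *v v = lvec 0 0 (v $ Some None)"
    using lightcone_parts[OF v h'] by (simp add: umat_vec vec_eq_parts x_def power2_norm_eq_inner)
  moreover have "flip 0 = (0 :: real^'a)" by (simp add: flip_def vec_eq_iff)
  ultimately have "g1 *v einf = lvec (v $ Some None) 0 0"
    by (simp add: g1_def matrix_vector_mul_assoc [symmetric] v_def [symmetric] sigma_vec)
  then have "g1 *v einf = exp (ln (v $ Some None)) *\<^sub>R einf" using h' by (simp add: vec_eq_parts)
  moreover have "preserves_bf g1" unfolding g1_def
    by (intro preserves_bf_mult sigma_preserves umat_preserves Gset_preserves g)
  moreover have "det g1 = 1" using g by (simp add: g1_def det_mul det_sigma det_umat Gset_iff)
  ultimately obtain m y where m: "m \<in> Mset" "g1 = m ** atorus (ln (v $ Some None)) ** umat y"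
    using parabolic_decomp by blast
  have "umat x ** sigma ** g1 = umat x ** (sigma ** sigma) ** umat (- x) ** g"
    by (simp add: g1_def matrix_mul_assoc)
  then have "g = umat x ** sigma ** g1" by (simp add: sigma_sigma umat_add umat_0)
  then have "g = umat x ** sigma ** m ** atorus (ln (v $ Some None)) ** umat y"
    by (simp add: m(2) matrix_mul_assoc)
  then show ?thesis using m(1) by (auto simp: bruhat_def x_def v_def)
qed

text \<open>Existence and uniqueness in the Bruhat decomposition evaluate both descriptions, so
  height and boundary point can be read off \<open>g *v einf\<close>.\<close>

lemma height_bdry:
  assumes g: "g \<in> Gset" and h: "(g *v einf) $ Some None > 0"
  shows "height g = (g *v einf) $ Some None" "bdry g = pos (g *v einf)"
proof -
  note B = bruhat_exists[OF assms]
  have "(THE r. \<exists>x. bruhat g x r) = ln ((g *v einf) $ Some None)"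
    by (rule the_equality) (use B in blast, metis bruhat_einf(1) ln_exp)
  then show "height g = (g *v einf) $ Some None" using h by (simp add: height_def)
  show "bdry g = pos (g *v einf)"
    unfolding bdry_def by (rule the_equality) (use B in blast, metis bruhat_einf(2))
qed

lemma Gset_height_pos_iff: "g \<in> Gset \<Longrightarrow> (g *v einf) $ Some None > 0 \<longleftrightarrow> g \<notin> Pset"
  using lightconeD(3)[OF lightcone_Gset[OF _ einf_lightcone]] Pset_iff by (metis less_le)

section \<open>Counting by covering\<close>

definition at_least :: "'a set \<Rightarrow> real \<Rightarrow> bool" where
  "at_least S N \<longleftrightarrow> infinite S \<or> N \<le> real (card S)"

lemma at_least_image:
  assumes "at_least S N" "inj_on f S" "f ` S \<subseteq> T"
  shows "at_least T N"
proof (cases "finite T")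
  case True
  then have "finite S" using assms(2,3) inj_on_finite by blast
  moreover have "card S \<le> card T" using True assms(2,3) by (metis card_inj_on_le)
  ultimately show ?thesis using assms(1) by (simp add: at_least_def)
qed (simp add: at_least_def)

lemma at_least_mono: "at_least S N \<Longrightarrow> S \<subseteq> T \<Longrightarrow> N' \<le> N \<Longrightarrow> at_least T N'"
  using at_least_image[of S N "\<lambda>x. x" T] by (auto simp: at_least_def)

lemma cball_cover_power:
  fixes f :: "'i \<Rightarrow> 'a::euclidean_space"
  assumes I: "finite I" and cover: "cball a r \<subseteq> (\<Union>i\<in>I. cball (f i) (s i))"
    and r: "r \<ge> 0" and s: "\<And>i. i \<in> I \<Longrightarrow> s i \<ge> 0"
  shows "r ^ DIM('a) \<le> (\<Sum>i\<in>I. s i ^ DIM('a))"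
proof -
  let ?v = "unit_ball_vol (real DIM('a))"
  have "?v * r ^ DIM('a) = measure lborel (cball a r)" using r by (simp add: content_cball)
  also have "\<dots> \<le> measure lborel (\<Union>i\<in>I. cball (f i) (s i))"
    using I cover
    by (intro measure_mono_fmeasurable) (auto intro!: fmeasurable_compact)
  also have "\<dots> \<le> (\<Sum>i\<in>I. measure lborel (cball (f i) (s i)))"
    using I by (intro measure_UNION_le) auto
  also have "\<dots> = ?v * (\<Sum>i\<in>I. s i ^ DIM('a))"
    using s by (simp add: content_cball sum_distrib_left)
  finally show ?thesis using unit_ball_vol_pos[of "real DIM('a)"] by simp
qed

text \<open>The balls of radius R about the points of S cover the ball of radius r; compare
  volumes.\<close>

lemma at_least_of_dense:
  fixes S :: "'a::euclidean_space set"
  assumes dense: "\<And>z. z \<in> cball a r \<Longrightarrow> \<exists>x\<in>S. dist z x \<le> R" and r: "r \<ge> 0" and R: "R > 0"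
  shows "at_least S ((r / R) ^ DIM('a))"
proof (cases "finite S")
  case True
  have "r ^ DIM('a) \<le> (\<Sum>x\<in>S. R ^ DIM('a))"
    using True dense r R
    by (intro cball_cover_power[where f="\<lambda>x. x" and a=a]) (auto simp: dist_commute)
  then show ?thesis using R by (simp add: at_least_def power_divide field_simps)
qed (simp add: at_least_def)

text \<open>A Vitali subfamily turns local lower bounds at all scales into a global one.\<close>

lemma at_least_of_local:
  fixes E :: "'a::euclidean_space set"
  assumes d: "d \<ge> 0" and H: "H \<ge> 0"
    and loc: "\<And>x. x \<in> cball a d \<Longrightarrow>
      \<exists>y r. 0 < r \<and> r \<le> d \<and> x \<in> ball y r \<and> at_least (E \<inter> cball y r) ((r * H) ^ DIM('a))"
  shows "at_least (E \<inter> cball a (3 * d)) ((d * H / 5) ^ DIM('a))"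
proof (cases "finite (E \<inter> cball a (3 * d))")
  case fin: True
  obtain f s where fs: "\<And>x. x \<in> cball a d \<Longrightarrow> 0 < s x \<and> s x \<le> d \<and> x \<in> ball (f x) (s x)
      \<and> at_least (E \<inter> cball (f x) (s x)) ((s x * H) ^ DIM('a))"
    using loc by metis
  have "cball a d \<subseteq> (\<Union>x\<in>cball a d. ball (f x) (s x))" using fs by blast
  \<comment> \<open>Compactness is applied to the open balls; the finite family is then closed up
    for the Vitali lemma.\<close>
  then obtain K where K: "K \<subseteq> cball a d" "finite K" "cball a d \<subseteq> (\<Union>x\<in>K. ball (f x) (s x))"
    using compactE_image[OF compact_cball, of "cball a d" "\<lambda>x. ball (f x) (s x)" a d] open_ball by metis
  have "cball a d \<subseteq> (\<Union>x\<in>K. cball (f x) (s x))" 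
    by (rule order_trans[OF K(3)]) (intro UN_mono order_refl ball_subset_cball)
  then obtain C where C: "C \<subseteq> K"
     "pairwise (\<lambda>i j. disjnt (cball (f i) (s i)) (cball (f j) (s j))) C"
     "cball a d \<subseteq> (\<Union>i\<in>C. cball (f i) (5 * s i))"
  proof (rule Vitali_covering_lemma_cballs)
    show "0 < s x \<and> s x \<le> d" if "x \<in> K" for x using fs[of x] that K(1) by auto
  qed (auto intro: that)
  have finC: "finite C" using C(1) K(2) finite_subset by blast
  \<comment> \<open>Such a ball has radius at most d and contains a point within d of a, whence the
    radius 3d.\<close>
  have sub: "E \<inter> cball (f x) (s x) \<subseteq> E \<inter> cball a (3 * d)" if "x \<in> C" for x
  proof -
    have x: "x \<in> cball a d" using that C(1) K(1) by auto
    have "dist a z \<le> 3 * d" if "dist (f x) z \<le> s x" for z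
      using fs[OF x] x that dist_triangle[of a z "f x"] dist_triangle[of a "f x" x]
      by (simp add: dist_commute)
    then show ?thesis by auto
  qed
  \<comment> \<open>The selected balls are disjoint, and enlarged five times they still cover; this
    is the origin of the factor 5.\<close>
  have "d ^ DIM('a) \<le> (\<Sum>x\<in>C. (5 * s x) ^ DIM('a))"
  proof (rule cball_cover_power[OF finC C(3) d])
    fix x assume "x \<in> C"
    then have "x \<in> cball a d" using C(1) K(1) by blast
    then show "5 * s x \<ge> 0" using fs[of x] by auto
  qed
  then have "(d * H / 5) ^ DIM('a) \<le> (\<Sum>x\<in>C. (5 * s x) ^ DIM('a)) * (H / 5) ^ DIM('a)"
    using H by (simp add: power_mult_distrib power_divide mult_right_mono divide_right_mono)
  also have "\<dots> = (\<Sum>x\<in>C. (s x * H) ^ DIM('a))"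
    unfolding sum_distrib_right power_mult_distrib [symmetric] by simp
  also have "\<dots> \<le> (\<Sum>x\<in>C. real (card (E \<inter> cball (f x) (s x))))"
  proof (intro sum_mono)
    fix x assume x: "x \<in> C"
    then have "at_least (E \<inter> cball (f x) (s x)) ((s x * H) ^ DIM('a))"
      using fs C(1) K(1) by blast
    moreover have "finite (E \<inter> cball (f x) (s x))" using sub[OF x] fin finite_subset by blast
    ultimately show "(s x * H) ^ DIM('a) \<le> real (card (E \<inter> cball (f x) (s x)))"
      by (simp add: at_least_def)
  qed
  also have "\<dots> = real (card (\<Union>x\<in>C. E \<inter> cball (f x) (s x)))"
  proof -
    have "card (\<Union>x\<in>C. E \<inter> cball (f x) (s x)) = (\<Sum>x\<in>C. card (E \<inter> cball (f x) (s x)))"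
    proof (rule card_UN_disjoint[OF finC])
      show "\<forall>x\<in>C. finite (E \<inter> cball (f x) (s x))" using sub fin finite_subset by blast
      show "\<forall>x\<in>C. \<forall>y\<in>C. x \<noteq> y \<longrightarrow>
          (E \<inter> cball (f x) (s x)) \<inter> (E \<inter> cball (f y) (s y)) = {}"
        using C(2) unfolding pairwise_def disjnt_def by blast
    qed
    then show ?thesis by simp
  qed
  also have "\<dots> \<le> real (card (E \<inter> cball a (3 * d)))"
    using sub by (intro of_nat_mono card_mono fin) auto
  finally show ?thesis by (simp add: at_least_def)
qed (simp add: at_least_def)

section \<open>Images of cusps and conjugates of unipotents\<close>

text \<open>The base point is a sum of two light-cone vectors, and both factors preserve the light
  cone, so its image stays in the future.\<close>

lemma Gset_mult:
  fixes g h :: "'m::finite gmat"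
  assumes g: "g \<in> Gset" and h: "h \<in> Gset"
  shows "g ** h \<in> Gset"
proof -
  have z: "lvec 0 0 1 \<in> (lightcone :: (real^('m idx)) set)" by (simp add: lightcone_def bf_def)
  let ?v = "g *v (h *v einf)" and ?w = "g *v (h *v lvec 0 0 1)"
  have "?v \<in> lightcone" "?w \<in> lightcone"
    by (intro lightcone_Gset g h z einf_lightcone)+
  then have "?v $ None + ?v $ Some None > 0" "?w $ None + ?w $ Some None > 0"
    by (simp_all add: lightconeD)
  moreover have "(g ** h) *v obase = ?v + ?w"
  proof -
    have "(obase :: real^('m idx)) = einf + lvec 0 0 1" by (simp add: obase_lvec vec_eq_parts)
    then show ?thesis by (metis matrix_vector_mul_assoc matrix_vector_right_distrib)
  qed
  ultimately have "bf ((g ** h) *v obase) obase > 0"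
    by (simp add: bf_def) (simp add: obase_lvec)
  then show ?thesis
    using g h by (simp add: Gset_iff preserves_bf_mult det_mul)
qed

text \<open>Two light-cone vectors lie over the same point exactly if they are orthogonal, and
  isometries preserve orthogonality.\<close>

lemma pos_image_inj:
  assumes p: "preserves_bf p" and v: "v \<in> lightcone" "v $ Some None > 0" "(p *v v) $ Some None > 0"
    and w: "w \<in> lightcone" "w $ Some None > 0" "(p *v w) $ Some None > 0"
    and l: "p *v v \<in> lightcone" "p *v w \<in> lightcone"
    and eq: "pos (p *v v) = pos (p *v w)"
  shows "pos v = pos w"
proof -
  have "bf (p *v v) (p *v w) = 0"
    using bf_lightcone[OF l(1) v(3) l(2) w(3)] eq by simp
  then have "bf v w = 0" by (simp add: preserves_bfD[OF p])
  then show ?thesis using bf_lightcone[OF v(1,2) w(1,2)] v(2) w(2) by simp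
qed

text \<open>The height of the image is the pairing of z with the preimage of \<open>einf\<close>,
  which has the same height as \<open>p *v einf\<close>. Pairing \<open>p *v z\<close> with
  \<open>p *v einf\<close>, which gives the height of z, then determines the distance.\<close>

lemma image_height:
  assumes p: "p \<in> Gset" and h: "(p *v einf) $ Some None > 0"
    and z: "z \<in> lightcone" "z $ Some None > 0"
  defines "d \<equiv> norm (pos z - pos (matrix_inv p *v einf))"
  shows "(p *v z) $ Some None = z $ Some None * (p *v einf) $ Some None * d ^ 2 / 2"
    and "d > 0 \<Longrightarrow> norm (pos (p *v z) - pos (p *v einf)) = 2 / ((p *v einf) $ Some None * d)"
proof -
  define w where "w = p *v einf"
  define q where "q = matrix_inv p *v einf"
  note P = Gset_preserves[OF p]
  have w: "w \<in> lightcone" "w $ Some None > 0"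
    using lightcone_Gset[OF p einf_lightcone] h by (simp_all add: w_def)
  have q: "q \<in> lightcone" unfolding q_def by (intro lightcone_Gset Gset_inv p einf_lightcone)
  have pz: "p *v z \<in> lightcone" by (rule lightcone_Gset[OF p z(1)])
  have qn: "q $ Some None = w $ Some None"
    using bf_inv[OF P, of einf einf] by (simp add: q_def w_def)
  have "(p *v z) $ Some None = bf q z"
    using bf_inv[OF P, of einf z] by (simp add: q_def)
  also have "\<dots> = z $ Some None * w $ Some None * d ^ 2 / 2"
    using bf_lightcone[OF q _ z] w(2)
    by (simp add: qn d_def q_def [symmetric] norm_minus_commute)
  finally have 1: "(p *v z) $ Some None = z $ Some None * w $ Some None * d ^ 2 / 2" .
  then show "(p *v z) $ Some None = z $ Some None * (p *v einf) $ Some None * d ^ 2 / 2"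
    by (simp add: w_def)
  show "norm (pos (p *v z) - pos (p *v einf)) = 2 / ((p *v einf) $ Some None * d)" if d: "d > 0"
    unfolding w_def [symmetric]
  proof -
    let ?h = "w $ Some None" and ?c = "z $ Some None" and ?n = "norm (pos (p *v z) - pos w)"
    have "(p *v z) $ Some None > 0" unfolding 1 using w z d by simp
    then have "bf (p *v z) w = (?c * ?h * d ^ 2 / 2) * ?h * ?n ^ 2 / 2"
      using bf_lightcone[OF pz _ w] by (simp add: 1)
    moreover have "bf (p *v z) w = ?c" by (simp add: w_def preserves_bfD[OF P])
    ultimately have "?c = (?c * ?h * d ^ 2 / 2) * ?h * ?n ^ 2 / 2" by simp
    then have "(?n * (?h * d)) ^ 2 = 2 ^ 2"
      using z(2) by (simp add: power2_eq_square field_simps)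
    then have "?n * (?h * d) = 2"
      using d w(2) by (elim power2_eq_imp_eq) auto
    then show "?n = 2 / (?h * d)" using d w(2) by (simp add: field_simps)
  qed
qed

lemma umat_lightcone:
  assumes "z \<in> lightcone" "z $ Some None > 0"
  shows "pos (umat x *v z) = pos z + x" "(umat x *v z) $ Some None = z $ Some None"
    "umat x *v z \<in> lightcone"
  using assms lightcone_Gset[OF umat_Gset] by (simp_all add: pos_def umat_vec scaleR_add_right)

lemma umat_inj:
  assumes "umat x = umat y"
  shows "x = y"
proof -
  have "mid (umat x *v lvec 0 0 1) = mid (umat y *v lvec 0 0 1)" using assms by simp
  then show ?thesis by (simp add: umat_vec)
qed

section \<open>Euclidean size and the displacement by conjugated unipotents\<close>

lemma bf_bound: "\<bar>bf v w\<bar> \<le> norm v * norm w"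
proof -
  \<comment> \<open>\<open>Jform\<close> swaps two coordinates and negates the others, so it is
    orthogonal.\<close>
  have "(Jform *v w) \<bullet> (Jform *v w) = w \<bullet> w"
    by (simp add: Jform_vec inner_parts)
  then have "norm (Jform *v w) = norm w" by (simp add: norm_eq_sqrt_inner)
  then show ?thesis by (metis bf_Jform Cauchy_Schwarz_ineq2)
qed

text \<open>Since v_0 + v_n is the pairing with the base point, the squared norm is minus the form
  on vectors orthogonal to the base point, and the square of v_0 + v_n on null vectors.\<close>

lemma norm_parts: "norm v ^ 2 = (v $ None + v $ Some None) ^ 2 - bf v v"
  for v :: "real^('m::finite idx)"
  unfolding power2_norm_eq_inner inner_parts bf_def by (simp add: power2_eq_square algebra_simps)

lemma lightcone_norm:
  assumes "v \<in> lightcone"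
  shows "norm v = v $ None + v $ Some None"
proof (rule power2_eq_imp_eq)
  show "norm v ^ 2 = (v $ None + v $ Some None) ^ 2"
    unfolding norm_parts lightconeD(1)[OF assms] by simp
  show "0 \<le> v $ None + v $ Some None" using lightconeD(4)[OF assms] by simp
qed simp

lemma norm_matrix_le:
  fixes A :: "real^'n^'n"
  assumes "\<And>v. norm (A *v v) \<le> b * norm v"
  shows "norm A \<le> real CARD('n) ^ 2 * b"
proof -
  have e: "\<bar>A $ i $ j\<bar> \<le> b" for i j
  proof -
    have "A $ i $ j = (A *v axis j 1) $ i" by (simp add: matrix_vector_mult_basis column_def)
    then have "\<bar>A $ i $ j\<bar> \<le> norm (A *v axis j 1)" by (metis component_le_norm_cart)
    also have "\<dots> \<le> b" using assms[of "axis j 1"] by simp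
    finally show ?thesis .
  qed
  have "norm A \<le> (\<Sum>i\<in>UNIV. norm (A $ i))"
    unfolding norm_vec_def by (rule L2_set_le_sum) simp
  also have "\<dots> \<le> (\<Sum>i\<in>(UNIV::'n set). real CARD('n) * b)"
  proof (intro sum_mono)
    fix i
    have "norm (A $ i) \<le> (\<Sum>j\<in>UNIV. \<bar>A $ i $ j\<bar>)" by (rule norm_le_l1_cart)
    also have "\<dots> \<le> (\<Sum>j\<in>(UNIV::'n set). b)" by (intro sum_mono e)
    finally show "norm (A $ i) \<le> real CARD('n) * b" by simp
  qed
  finally show ?thesis by (simp add: power2_eq_square)
qed

text \<open>The displacement of v is a combination of w, of norm s, and of an image l of the
  direction x, with coefficients controlled by \<open>bf_bound\<close>. It is small when the cusp
  vector is short, which will contradict discreteness.\<close>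

lemma conj_unipotent_bound:
  assumes p: "p \<in> Gset"
  defines "s \<equiv> (p *v einf) $ None + (p *v einf) $ Some None"
  shows "norm ((p ** umat x ** matrix_inv p) *v v - v) \<le> (2 * s * norm x + s ^ 2 * norm x ^ 2 / 2) * norm v"
proof -
  note P = Gset_preserves[OF p]
  define w where "w = p *v einf"
  have w: "w \<in> lightcone" unfolding w_def by (rule lightcone_Gset[OF p einf_lightcone])
  have s: "s > 0" "norm w = s" using lightconeD[OF w] lightcone_norm[OF w] by (simp_all add: s_def w_def)
  txt \<open>Adding a multiple of \<open>einf\<close> to the direction \<open>x\<close> does not change the unipotent map;
    this multiple makes the image orthogonal to the base point, hence of norm \<open>norm x\<close>.\<close>
  define l0 where "l0 = p *v lvec 0 x 0"
  define k where "k = - (l0 $ None + l0 $ Some None) / s"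
  define y where "y = lvec 0 x 0 + k *\<^sub>R einf"
  define l where "l = p *v y"
  have l_eq: "l = l0 + k *\<^sub>R w"
    by (simp add: l_def y_def l0_def w_def matrix_vector_right_distrib matrix_vector_mult_scaleR)
  have "l $ None + l $ Some None = (l0 $ None + l0 $ Some None) + k * s"
    by (simp add: l_eq s_def w_def algebra_simps)
  also have "\<dots> = 0" using s(1) by (simp add: k_def)
  finally have "norm l ^ 2 = - bf y y" by (simp add: norm_parts l_def preserves_bfD[OF P])
  also have "\<dots> = norm x ^ 2" by (simp add: y_def bf_def power2_norm_eq_inner)
  finally have l: "norm l = norm x" by (simp add: power2_eq_iff_nonneg)
  \<comment> \<open>The unipotent map written through the form alone, so that p can be applied term
    by term.\<close>
  have u: "umat x *v u - u = bf u einf *\<^sub>R y - bf u y *\<^sub>R einf + (norm x ^ 2 / 2 * bf u einf) *\<^sub>R einf" for u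
    by (simp add: y_def bf_linear umat_vec vec_eq_parts) (simp add: bf_def inner_commute algebra_simps)
  define u where "u = matrix_inv p *v v"
  have v: "v = p *v u" by (simp add: u_def preserves_bf_inv_vec[OF P])
  have b: "bf u einf = bf v w" "bf u y = bf v l" unfolding v w_def l_def by (simp_all add: preserves_bfD[OF P])
  have b1: "\<bar>bf v w\<bar> \<le> norm v * s" and b2: "\<bar>bf v l\<bar> \<le> norm v * norm x"
    using bf_bound[of v w] bf_bound[of v l] by (simp_all only: s l)
  have "(p ** umat x ** matrix_inv p) *v v - v = p *v (umat x *v u - u)"
    by (simp add: matrix_vector_mult_diff_distrib v [symmetric]) (simp add: matrix_vector_mul_assoc u_def matrix_mul_assoc)
  also have "\<dots> = bf v w *\<^sub>R l - bf v l *\<^sub>R w + (norm x ^ 2 / 2 * bf v w) *\<^sub>R w"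
    unfolding u matrix_vector_right_distrib matrix_vector_mult_diff_distrib matrix_vector_mult_scaleR b
    by (simp add: l_def w_def)
  also have "norm \<dots> \<le> \<bar>bf v w\<bar> * norm l + \<bar>bf v l\<bar> * norm w + (norm x ^ 2 / 2 * \<bar>bf v w\<bar>) * norm w"
    by (rule order_trans[OF norm_triangle_ineq add_mono[OF order_trans[OF norm_triangle_ineq4]]])
       (simp_all add: abs_mult)
  also have "\<dots> \<le> (norm v * s) * norm x + (norm v * norm x) * s + (norm x ^ 2 / 2 * (norm v * s)) * s"
    unfolding l s(2) using b1 b2 s(1) by (intro add_mono mult_right_mono mult_left_mono) auto
  finally show ?thesis by (simp add: power2_eq_square algebra_simps)
qed

section \<open>Dirichlet approximation by cusps\<close>

text \<open>The lattice of (ii) at the cusp of \<xi>, read in the Euclidean coordinates of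
  N.\<close>

definition cusp_lattice :: "'m::finite gmat set \<Rightarrow> 'm gmat \<Rightarrow> (real^'m) set" where
  "cusp_lattice \<Gamma> \<xi> = {x. \<xi> ** umat x ** matrix_inv \<xi> \<in> \<Gamma>}"

lemma cusp_lattice_dense:
  assumes xi: "\<xi> \<in> Gset" and lat: "cocompact_lattice (\<Gamma> \<inter> conjN \<xi>) (conjN \<xi>)"
  shows "\<exists>R. \<forall>x. \<exists>y\<in>cusp_lattice \<Gamma> \<xi>. dist x y \<le> R"
proof -
  note I = preserves_bf_inv[OF Gset_preserves[OF xi]]
  obtain C where C: "compact C" "C \<subseteq> conjN \<xi>" "conjN \<xi> = setmul (\<Gamma> \<inter> conjN \<xi>) C"
    using lat by (auto simp: cocompact_lattice_def)
  \<comment> \<open>This recovers y from the conjugate of u(y) by \<xi>. It is linear in the matrix,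
    hence bounded on the compact set C.\<close>
  define f where "f g = mid (matrix_inv \<xi> *v (g *v (\<xi> *v lvec 0 0 1)))" for g
  have "linear f"
    by (rule linearI)
      (simp_all add: f_def matrix_vector_mult_add_rdistrib matrix_vector_right_distrib
        scaleR_matrix_vector_assoc [symmetric] matrix_vector_mult_scaleR)
  then have "bounded (f ` C)"
    using C(1) bounded_linear_image compact_imp_bounded linear_conv_bounded_linear by blast
  then obtain R where R: "\<And>g. g \<in> C \<Longrightarrow> norm (f g) \<le> R" by (auto simp: bounded_iff)
  have f: "f (\<xi> ** umat y ** matrix_inv \<xi>) = y" for y
    using preserves_bf_inv_vec[OF Gset_preserves[OF xi]]
    by (simp add: f_def matrix_vector_mul_assoc [symmetric] umat_vec)
  have mult: "(\<xi> ** umat y ** matrix_inv \<xi>) ** (\<xi> ** umat z ** matrix_inv \<xi>) = \<xi> ** umat (y + z) ** matrix_inv \<xi>" for y z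
  proof -
    have "(\<xi> ** umat y ** matrix_inv \<xi>) ** (\<xi> ** umat z ** matrix_inv \<xi>)
        = \<xi> ** umat y ** (matrix_inv \<xi> ** \<xi>) ** umat z ** matrix_inv \<xi>" by (simp add: matrix_mul_assoc)
    then show ?thesis by (simp add: I umat_add [symmetric] matrix_mul_assoc)
  qed
  have "\<exists>y\<in>cusp_lattice \<Gamma> \<xi>. dist x y \<le> R" for x
  proof -
    have "\<xi> ** umat x ** matrix_inv \<xi> \<in> setmul (\<Gamma> \<inter> conjN \<xi>) C"
      unfolding C(3) [symmetric] by (auto simp: conjN_def Nset_def)
    then obtain g c where gc: "g \<in> \<Gamma>" "g \<in> conjN \<xi>" "c \<in> C" "\<xi> ** umat x ** matrix_inv \<xi> = g ** c"
      by (auto simp: setmul_def)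
    obtain y where y: "g = \<xi> ** umat y ** matrix_inv \<xi>" using gc(2) by (auto simp: conjN_def Nset_def)
    obtain z where z: "c = \<xi> ** umat z ** matrix_inv \<xi>"
      using gc(3) C(2) by (auto simp: conjN_def Nset_def)
    have "f (\<xi> ** umat x ** matrix_inv \<xi>) = f (\<xi> ** umat (y + z) ** matrix_inv \<xi>)"
      using gc(4) y z mult by simp
    then have "x = y + z" by (simp add: f)
    then have "dist x y \<le> R" using R[OF gc(3)] by (simp add: z f dist_norm)
    moreover have "y \<in> cusp_lattice \<Gamma> \<xi>" using gc(1) y by (simp add: cusp_lattice_def)
    ultimately show ?thesis by blast
  qed
  then show ?thesis by blast
qed

locale cusp_data =
  fixes \<Gamma> :: "'m::finite gmat set" and \<Xi> :: "'m gmat set" and s0 :: real and eta0 :: "'m gmat set"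
  assumes Gamma_sub: "is_subgroup \<Gamma> Gset"
    and Gamma_discrete: "discrete_set \<Gamma>"
    and s0_pos: "s0 > 0"
    and eta0: "eta0 \<subseteq> Nset"
    and Xi: "finite \<Xi>" "\<Xi> \<subseteq> Gset" "mat 1 \<in> \<Xi>"
    and cover: "Gset = setmul \<Gamma> (setmul \<Xi> (Omega eta0 s0))"
    and lattices: "\<forall>\<xi>\<in>\<Xi>. cocompact_lattice (\<Gamma> \<inter> conjN \<xi>) (conjN \<xi>)"
begin

lemma Gamma_Gset: "g \<in> \<Gamma> \<Longrightarrow> g \<in> Gset"
  and Gamma_one: "mat 1 \<in> \<Gamma>"
  and Gamma_mult: "g \<in> \<Gamma> \<Longrightarrow> h \<in> \<Gamma> \<Longrightarrow> g ** h \<in> \<Gamma>"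
  and Gamma_inv: "g \<in> \<Gamma> \<Longrightarrow> matrix_inv g \<in> \<Gamma>"
  using Gamma_sub by (auto simp: is_subgroup_def)

lemma uniform_radius:
  obtains R0 where "R0 \<ge> 1" "\<And>\<xi> x. \<xi> \<in> \<Xi> \<Longrightarrow> \<exists>y\<in>cusp_lattice \<Gamma> \<xi>. dist x y \<le> R0"
proof -
  have "\<forall>\<xi>\<in>\<Xi>. eventually (\<lambda>R. \<forall>x. \<exists>y\<in>cusp_lattice \<Gamma> \<xi>. dist x y \<le> R) at_top"
  proof
    fix \<xi> assume xi: "\<xi> \<in> \<Xi>"
    obtain R1 where R1: "\<forall>x. \<exists>y\<in>cusp_lattice \<Gamma> \<xi>. dist x y \<le> R1"
      using cusp_lattice_dense[of \<xi> \<Gamma>] xi lattices Xi(2) by auto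
    show "eventually (\<lambda>R. \<forall>x. \<exists>y\<in>cusp_lattice \<Gamma> \<xi>. dist x y \<le> R) at_top"
      using eventually_ge_at_top[of R1] by eventually_elim (meson R1 order_trans)
  qed
  then have "eventually (\<lambda>R. \<forall>\<xi>\<in>\<Xi>. \<forall>x. \<exists>y\<in>cusp_lattice \<Gamma> \<xi>. dist x y \<le> R) at_top"
    by (rule eventually_ball_finite[OF Xi(1)])
  then have "eventually (\<lambda>R::real. R \<ge> 1 \<and> (\<forall>\<xi>\<in>\<Xi>. \<forall>x. \<exists>y\<in>cusp_lattice \<Gamma> \<xi>. dist x y \<le> R)) at_top"
    using eventually_ge_at_top[of 1] by eventually_elim auto
  then obtain R where "R \<ge> 1 \<and> (\<forall>\<xi>\<in>\<Xi>. \<forall>x. \<exists>y\<in>cusp_lattice \<Gamma> \<xi>. dist x y \<le> R)"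
    using eventually_happens'[OF trivial_limit_at_top_linorder] by blast
  then show thesis using that by blast
qed

text \<open>A lattice point within R of a vector of length R + 1 is nonzero and has length at most
  2R + 1.\<close>

lemma nonzero_lattice_vector:
  obtains L where "L > 0" "\<And>\<xi>. \<xi> \<in> \<Xi> \<Longrightarrow> \<exists>y\<in>cusp_lattice \<Gamma> \<xi>. y \<noteq> 0 \<and> norm y \<le> L"
proof -
  obtain R where R: "R \<ge> 1" "\<And>\<xi> x. \<xi> \<in> \<Xi> \<Longrightarrow> \<exists>y\<in>cusp_lattice \<Gamma> \<xi>. dist x y \<le> R"
    using uniform_radius by blast
  obtain x :: "real^'m" where x: "norm x = R + 1"
    using vector_choose_size[of "R + 1"] R(1) by auto
  have "\<exists>y\<in>cusp_lattice \<Gamma> \<xi>. y \<noteq> 0 \<and> norm y \<le> 2 * R + 1" if xi: "\<xi> \<in> \<Xi>" for \<xi>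
  proof -
    obtain y where y: "y \<in> cusp_lattice \<Gamma> \<xi>" "dist x y \<le> R" using R(2)[OF xi] by blast
    have "y \<noteq> 0" using y(2) x by auto
    moreover have "norm y \<le> norm x + dist x y"
      by (metis dist_norm norm_minus_commute norm_triangle_sub)
    ultimately show ?thesis using y x by (intro bexI[OF _ y(1)]) auto
  qed
  then show thesis using that[of "2 * R + 1"] R(1) by force
qed

text \<open>If \<open>\<gamma>\<xi>e\<close> were too short, conjugating a fixed unipotent element of the cusp \<open>\<xi>\<close> by \<open>\<gamma>\<xi>\<close> would
  produce a nontrivial element of \<open>\<Gamma>\<close> too close to the identity.\<close>

lemma cusp_vectors_bounded_below:
  obtains \<epsilon> where "\<epsilon> > 0"
    "\<And>\<gamma> \<xi>. \<gamma> \<in> \<Gamma> \<Longrightarrow> \<xi> \<in> \<Xi> \<Longrightarrow>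
       \<epsilon> \<le> ((\<gamma> ** \<xi>) *v einf) $ None + ((\<gamma> ** \<xi>) *v einf) $ Some None"
proof -
  obtain L where L: "L > 0" "\<And>\<xi>. \<xi> \<in> \<Xi> \<Longrightarrow> \<exists>y\<in>cusp_lattice \<Gamma> \<xi>. y \<noteq> 0 \<and> norm y \<le> L"
    using nonzero_lattice_vector by blast
  obtain e where e: "e > 0" "\<And>g. g \<in> \<Gamma> \<Longrightarrow> dist g (mat 1) < e \<Longrightarrow> g = mat 1"
    using Gamma_discrete Gamma_one by (auto simp: discrete_set_def)
  define N where "N = real CARD('m idx) ^ 2"
  \<comment> \<open>For s < \<epsilon> \<le> 1 and a lattice vector of length at most L, the
    displacement bound is at most N (2L + L^2) \<epsilon>, hence at most e / 2.\<close>
  define \<epsilon> where "\<epsilon> = min 1 (e / (2 * N * (2 * L + L ^ 2)))"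
  have N: "N > 0" by (simp add: N_def)
  have pos: "2 * L + L ^ 2 > 0" using L(1) by (simp add: add_pos_pos)
  have eps: "\<epsilon> > 0" using e(1) N pos by (simp add: \<epsilon>_def)
  have "\<epsilon> \<le> ((\<gamma> ** \<xi>) *v einf) $ None + ((\<gamma> ** \<xi>) *v einf) $ Some None" (is "_ \<le> ?s")
    if g: "\<gamma> \<in> \<Gamma>" and xi: "\<xi> \<in> \<Xi>" for \<gamma> \<xi>
  proof (rule ccontr)
    assume "\<not> ?thesis"
    then have s: "?s < \<epsilon>" by simp
    have p: "\<gamma> ** \<xi> \<in> Gset" using g xi Xi(2) Gamma_Gset by (auto intro: Gset_mult)
    have s0: "?s > 0" using lightconeD(4)[OF lightcone_Gset[OF p einf_lightcone]] .
    obtain y where y: "\<xi> ** umat y ** matrix_inv \<xi> \<in> \<Gamma>" "y \<noteq> 0" "norm y \<le> L"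
      using L(2)[OF xi] by (auto simp: cusp_lattice_def)
    have xi': "preserves_bf \<xi>" and g': "preserves_bf \<gamma>" using xi Xi(2) g Gamma_Gset Gset_preserves by auto
    have "matrix_inv (\<gamma> ** \<xi>) = matrix_inv \<xi> ** matrix_inv \<gamma>"
    proof -
      have "matrix_inv (\<gamma> ** \<xi>) = matrix_inv (\<gamma> ** \<xi>) ** (\<gamma> ** (\<xi> ** matrix_inv \<xi>) ** matrix_inv \<gamma>)"
        by (simp add: preserves_bf_inv[OF xi'] preserves_bf_inv[OF g'])
      also have "\<dots> = (matrix_inv (\<gamma> ** \<xi>) ** (\<gamma> ** \<xi>)) ** (matrix_inv \<xi> ** matrix_inv \<gamma>)"
        by (simp add: matrix_mul_assoc)
      finally show ?thesis by (simp add: preserves_bf_inv[OF preserves_bf_mult[OF g' xi']])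
    qed
    then have "(\<gamma> ** \<xi>) ** umat y ** matrix_inv (\<gamma> ** \<xi>) = \<gamma> ** (\<xi> ** umat y ** matrix_inv \<xi>) ** matrix_inv \<gamma>"
      (is "?c = _") by (simp add: matrix_mul_assoc)
    then have c: "?c \<in> \<Gamma>" using y(1) g Gamma_mult Gamma_inv by simp
    have "norm (?c - mat 1) \<le> N * (2 * ?s * norm y + ?s ^ 2 * norm y ^ 2 / 2)"
      unfolding N_def
    proof (rule norm_matrix_le)
      fix v
      have "(?c - mat 1) *v v = ?c *v v - v" by (simp add: matrix_vector_mult_diff_rdistrib)
      then show "norm ((?c - mat 1) *v v) \<le> (2 * ?s * norm y + ?s ^ 2 * norm y ^ 2 / 2) * norm v"
        using conj_unipotent_bound[OF p] by simp
    qed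
    also have "\<dots> \<le> N * (2 * \<epsilon> * L + \<epsilon> * L ^ 2)"
    proof (intro mult_left_mono add_mono)
      show "2 * ?s * norm y \<le> 2 * \<epsilon> * L" using s s0 y(3) by (intro mult_mono) auto
      have "?s ^ 2 \<le> \<epsilon> * 1" unfolding power2_eq_square using s s0 \<epsilon>_def by (intro mult_mono) auto
      then have "?s ^ 2 * norm y ^ 2 \<le> \<epsilon> * L ^ 2" using y(3) eps by (intro mult_mono power_mono) auto
      moreover have "?s ^ 2 * norm y ^ 2 / 2 \<le> ?s ^ 2 * norm y ^ 2" by simp
      ultimately show "?s ^ 2 * norm y ^ 2 / 2 \<le> \<epsilon> * L ^ 2" by linarith
    qed (use N in simp)
    also have "\<dots> = (N * (2 * L + L ^ 2)) * \<epsilon>" by (simp add: algebra_simps)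
    also have "\<dots> \<le> (N * (2 * L + L ^ 2)) * (e / (2 * N * (2 * L + L ^ 2)))"
      using N pos by (intro mult_left_mono) (auto simp: \<epsilon>_def)
    also have "\<dots> = e / 2"
    proof -
      have "M * (e / (2 * M)) = e / 2" if "M > 0" for M :: real using that by simp
      from this[of "N * (2 * L + L ^ 2)"] show ?thesis using N pos by (simp add: mult.assoc)
    qed
    also have "\<dots> < e" using e(1) by simp
    finally have "?c = mat 1" using e(2)[OF c] by (simp add: dist_norm)
    then have "matrix_inv (\<gamma> ** \<xi>) ** ?c ** (\<gamma> ** \<xi>) = mat 1"
      by (simp add: preserves_bf_inv[OF preserves_bf_mult[OF g' xi']])
    moreover have "matrix_inv (\<gamma> ** \<xi>) ** ?c ** (\<gamma> ** \<xi>)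
        = (matrix_inv (\<gamma> ** \<xi>) ** (\<gamma> ** \<xi>)) ** umat y ** (matrix_inv (\<gamma> ** \<xi>) ** (\<gamma> ** \<xi>))"
      by (simp add: matrix_mul_assoc)
    ultimately have "umat y = umat 0"
      by (simp add: preserves_bf_inv[OF preserves_bf_mult[OF g' xi']] umat_0)
    then show False using y(2) umat_inj by blast
  qed
  then show thesis using that eps by blast
qed

text \<open>Write u(x) a(-t) = \<gamma> \<xi> v a(s) k by the covering. The inverse of the left side
  carries \<gamma>\<xi>e to exp (-s) times the preimage c of e under k. As k fixes the base point,
  the null coordinates of c sum to 1, so those of the result sum to exp (-s) \<le> 1.\<close>

lemma dirichlet:
  obtains \<gamma> \<xi> where "\<gamma> \<in> \<Gamma>" "\<xi> \<in> \<Xi>"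
    "exp t * (umat (- x) *v ((\<gamma> ** \<xi>) *v einf)) $ None
      + exp (- t) * (umat (- x) *v ((\<gamma> ** \<xi>) *v einf)) $ Some None \<le> 1"
proof -
  define g where "g = umat x ** atorus (- t)"
  have "g \<in> setmul \<Gamma> (setmul \<Xi> (Omega eta0 s0))"
    using umat_atorus_Gset[of x "- t"] cover by (simp add: g_def)
  then obtain \<gamma> \<xi> v s k where d: "\<gamma> \<in> \<Gamma>" "\<xi> \<in> \<Xi>" "v \<in> eta0" "s0 \<le> s" "k \<in> Kset"
    "g = \<gamma> ** (\<xi> ** (v ** atorus s ** k))"
    unfolding setmul_def Omega_def by blast
  have k: "k \<in> Gset" "k *v obase = obase" using d(5) by (auto simp: Kset_def)
  note Pk = Gset_preserves[OF k(1)]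
  define c where "c = matrix_inv k *v einf"
  define w where "w = (\<gamma> ** \<xi>) *v einf"
  have c1: "c $ None + c $ Some None = 1"
  proof -
    have "bf c obase = bf einf (k *v obase)" by (simp add: c_def bf_inv[OF Pk])
    also have "\<dots> = 1" unfolding k(2) by (simp add: obase_lvec)
    finally show ?thesis by (simp add: bf_def obase_lvec)
  qed
  obtain y where y: "v = umat y" using d(3) eta0 by (auto simp: Nset_def)
  have "g *v c = exp s *\<^sub>R w"
    by (simp add: d(6) y matrix_vector_mul_assoc [symmetric] c_def preserves_bf_inv_vec[OF Pk] w_def
        matrix_vector_mult_scaleR)
  moreover have "umat (- x) *v (g *v c) = atorus (- t) *v c"
    by (simp add: g_def matrix_vector_mul_assoc matrix_mul_assoc umat_add umat_0)
  ultimately have z: "exp s *\<^sub>R (umat (- x) *v w) = atorus (- t) *v c"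
    by (simp add: matrix_vector_mult_scaleR)
  have "exp s * (exp t * (umat (- x) *v w) $ None + exp (- t) * (umat (- x) *v w) $ Some None)
      = exp t * (exp s *\<^sub>R (umat (- x) *v w)) $ None + exp (- t) * (exp s *\<^sub>R (umat (- x) *v w)) $ Some None"
    by (simp add: algebra_simps)
  also have "\<dots> = 1" unfolding z using c1 by (simp add: atorus_vec exp_minus field_simps)
  finally have "exp t * (umat (- x) *v w) $ None + exp (- t) * (umat (- x) *v w) $ Some None = 1 / exp s"
    by (simp add: field_simps)
  also have "\<dots> \<le> 1" using d(4) s0_pos by simp
  finally show thesis using that d(1,2) by (simp add: w_def)
qed

text \<open>For z = u(-x) w the previous lemma reads H z_0 + h / H \<le> 1, where z_0 is h/2 times
  the squared distance from \<open>pos w\<close> to x. This gives both upper bounds. For the lower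
  one, z_0 \<le> \<epsilon>/4 and w_0 \<le> 2 z_0 + h, while w_0 + h is at least \<epsilon>.\<close>

lemma dirichlet_cusp:
  obtains \<epsilon> where "\<epsilon> > 0"
    "\<And>H x. H \<ge> 4 / \<epsilon> \<Longrightarrow> norm x \<le> 1 \<Longrightarrow> \<exists>\<gamma>\<in>\<Gamma>. \<exists>\<xi>\<in>\<Xi>. let w = (\<gamma> ** \<xi>) *v einf; h = w $ Some None in
       \<epsilon> / 4 \<le> h \<and> h \<le> H \<and> h * H * norm (pos w - x) ^ 2 \<le> 2"
proof -
  obtain \<epsilon> where e: "\<epsilon> > 0" "\<And>\<gamma> \<xi>. \<gamma> \<in> \<Gamma> \<Longrightarrow> \<xi> \<in> \<Xi> \<Longrightarrow>
       \<epsilon> \<le> ((\<gamma> ** \<xi>) *v einf) $ None + ((\<gamma> ** \<xi>) *v einf) $ Some None"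
    using cusp_vectors_bounded_below by blast
  have "\<exists>\<gamma>\<in>\<Gamma>. \<exists>\<xi>\<in>\<Xi>. let w = (\<gamma> ** \<xi>) *v einf; h = w $ Some None in
       \<epsilon> / 4 \<le> h \<and> h \<le> H \<and> h * H * norm (pos w - x) ^ 2 \<le> 2"
    if H: "H \<ge> 4 / \<epsilon>" and x: "norm x \<le> 1" for H x
  proof -
    have H0: "H > 0" using H e(1) by (meson divide_pos_pos less_le_trans zero_less_numeral)
    obtain \<gamma> \<xi> where d: "\<gamma> \<in> \<Gamma>" "\<xi> \<in> \<Xi>" and
      d3: "exp (ln H) * (umat (- x) *v ((\<gamma> ** \<xi>) *v einf)) $ None
       + exp (- ln H) * (umat (- x) *v ((\<gamma> ** \<xi>) *v einf)) $ Some None \<le> 1"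
      using dirichlet by blast
    define w where "w = (\<gamma> ** \<xi>) *v einf"
    define z where "z = umat (- x) *v w"
    define h where "h = w $ Some None"
    have w: "w \<in> lightcone" unfolding w_def
      using d Xi(2) Gamma_Gset by (intro lightcone_Gset Gset_mult einf_lightcone) auto
    have z: "z \<in> lightcone" unfolding z_def by (intro lightcone_Gset umat_Gset w)
    have zn: "z $ Some None = h" by (simp add: z_def h_def umat_vec)
    have z0: "z $ None \<ge> 0" "h \<ge> 0" using lightconeD[OF z] zn by auto
    have *: "H * z $ None + h / H \<le> 1" using d3 H0 by (simp add: z_def [symmetric] w_def [symmetric] zn exp_minus field_simps)
    have hH: "h \<le> H" and Hz: "H * z $ None \<le> 1"
    proof -
      have "h / H \<le> 1" using * z0 H0 by (smt (verit) mult_nonneg_nonneg)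
      then show "h \<le> H" using H0 by (simp add: field_simps)
      have "0 \<le> h / H" using z0 H0 by simp
      then show "H * z $ None \<le> 1" using * by linarith
    qed
    have zH: "z $ None \<le> \<epsilon> / 4"
    proof -
      have "4 \<le> H * \<epsilon>" using H e(1) by (simp add: field_simps)
      then have "4 * z $ None \<le> (H * \<epsilon>) * z $ None" using z0 by (intro mult_right_mono)
      also have "\<dots> = \<epsilon> * (H * z $ None)" by simp
      also have "\<dots> \<le> \<epsilon> * 1" using Hz e(1) by (intro mult_left_mono) auto
      finally show ?thesis by simp
    qed
    \<comment> \<open>As z is null, the squared length of its middle part is 2 z_0 h; then the
      inequality of means applies.\<close>
    have mid: "x \<bullet> mid z \<le> z $ None + h / 2"
    proof -
      have "(norm (mid z)) ^ 2 = 2 * (z $ None * h)"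
        using lightconeD(1)[OF z] by (simp add: bf_def zn power2_norm_eq_inner mult.commute)
      also have "\<dots> \<le> (z $ None + h / 2) ^ 2"
        using zero_le_power2[of "z $ None - h / 2"] by (simp add: power2_eq_square algebra_simps)
      finally have "norm (mid z) \<le> z $ None + h / 2" by (rule power2_le_imp_le) (use z0 in simp)
      moreover have "x \<bullet> mid z \<le> norm x * norm (mid z)" by (rule norm_cauchy_schwarz)
      moreover have "\<dots> \<le> 1 * norm (mid z)" using x by (intro mult_right_mono) auto
      ultimately show ?thesis by linarith
    qed
    have "w = umat x *v z"
      by (simp add: z_def matrix_vector_mul_assoc umat_add umat_0)
    then have "w $ None = z $ None + norm x ^ 2 / 2 * h + x \<bullet> mid z" by (simp add: umat_vec zn)
    moreover have "norm x ^ 2 / 2 * h \<le> 1 / 2 * h"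
      using x z0 by (intro mult_right_mono) (simp_all add: power_le_one)
    moreover have "\<epsilon> \<le> w $ None + h" using e(2)[OF d] by (simp add: w_def h_def)
    ultimately have heps: "\<epsilon> / 4 \<le> h" using mid zH by linarith
    then have hp: "h > 0" using e(1) by linarith
    have "pos z = pos w - x"
      using umat_lightcone(1)[OF w, of "- x"] hp by (simp add: z_def h_def)
    moreover have "z $ None = h * norm (pos z) ^ 2 / 2"
      using lightcone_parts(1)[OF z] hp by (simp add: zn)
    ultimately have "h * H * norm (pos w - x) ^ 2 = 2 * (H * z $ None)" by simp
    then have "h * H * norm (pos w - x) ^ 2 \<le> 2" using Hz by linarith
    then show ?thesis using heps hH d unfolding Let_def w_def h_def by blast
  qed
  then show thesis using that e(1) by blast
qed

end

section \<open>Counting one orbit of cusps\<close>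

context cusp_data
begin

text \<open>If the orbit of \<open>e\<close> were the single point \<open>\<xi>\<infinity>\<close>, then \<open>\<Gamma> \<subseteq> P\<close>; as a nontrivial unipotent element
  has a single fixed point, all cusps would be \<open>\<infinity>\<close>, against the covering by cusp neighbourhoods.\<close>

lemma cusp_orbit_nontrivial:
  assumes xi: "\<xi> \<in> \<Xi>"
  obtains \<gamma> where "\<gamma> \<in> \<Gamma>" "(matrix_inv \<xi> *v (\<gamma> *v einf)) $ Some None > 0"
proof -
  have "\<exists>\<gamma>\<in>\<Gamma>. (matrix_inv \<xi> *v (\<gamma> *v einf)) $ Some None > 0"
  proof (rule ccontr)
    assume neg: "\<not> ?thesis"
    have xi': "\<xi> \<in> Gset" using xi Xi(2) by auto
    have orth: "bf (\<gamma> *v einf) (\<xi> *v einf) = 0" if g: "\<gamma> \<in> \<Gamma>" for \<gamma>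
    proof -
      have "matrix_inv \<xi> *v (\<gamma> *v einf) \<in> lightcone"
        using g Gamma_Gset xi' by (intro lightcone_Gset Gset_inv einf_lightcone) auto
      then have "(matrix_inv \<xi> *v (\<gamma> *v einf)) $ Some None = 0"
        using lightconeD(3) neg g by (metis less_le)
      then show ?thesis
        using bf_inv[OF Gset_preserves[OF xi'], of "\<gamma> *v einf" einf] by simp
    qed
    \<comment> \<open>The identity element shows \<xi>\<infinity> = \<infinity>, after which all of
      \<Gamma> fixes \<infinity>.\<close>
    have "bf (\<xi> *v einf) einf = 0" using orth[OF Gamma_one] by (simp add: bf_commute)
    then have "\<xi> *v einf = (\<xi> *v einf) $ None *\<^sub>R einf" "(\<xi> *v einf) $ None > 0"
      using lightcone_orthogonal_einf[OF lightcone_Gset[OF xi' einf_lightcone]] by blast+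
    then have fix_inf: "bf (\<gamma> *v einf) einf = 0" if "\<gamma> \<in> \<Gamma>" for \<gamma>
      using orth[OF that] by (metis bf_linear(7) less_irrefl mult_eq_0_iff)
    have all_inf: "((\<gamma> ** \<zeta>) *v einf) $ Some None = 0" if g: "\<gamma> \<in> \<Gamma>" and z: "\<zeta> \<in> \<Xi>" for \<gamma> \<zeta>
    proof -
      have z': "\<zeta> \<in> Gset" using z Xi(2) by auto
      note Pz = Gset_preserves[OF z']
      obtain y where y: "y \<in> cusp_lattice \<Gamma> \<zeta>" "y \<noteq> 0" using nonzero_lattice_vector z by metis
      define q where "q = matrix_inv \<zeta> *v einf"
      have q: "q \<in> lightcone" unfolding q_def by (intro lightcone_Gset Gset_inv z' einf_lightcone)
      have "bf ((\<zeta> ** umat y ** matrix_inv \<zeta>) *v einf) einf = 0"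
        using y(1) fix_inf by (simp add: cusp_lattice_def)
      then have "bf (\<zeta> *v (umat y *v q)) (\<zeta> *v q) = 0"
        by (simp add: q_def matrix_vector_mul_assoc [symmetric] preserves_bf_inv_vec[OF Pz])
      then have 0: "bf (umat y *v q) q = 0" by (simp add: preserves_bfD[OF Pz])
      \<comment> \<open>Seen from the cusp of \<zeta>, the lattice element is the translation by y
        \<noteq> 0, which moves every finite boundary point; q is fixed, so it lies over
        \<infinity>.\<close>
      have "\<not> q $ Some None > 0"
      proof
        assume qn: "q $ Some None > 0"
        note U = umat_lightcone[OF q qn, of y]
        show False using bf_lightcone[OF U(3) _ q qn] U qn 0 y(2) by simp
      qed
      then have "q $ Some None = 0" using lightconeD(3)[OF q] by simp
      then have "bf (\<zeta> *v einf) einf = 0"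
        using bf_inv[OF Pz, of einf einf] by (simp add: q_def)
      then have "\<zeta> *v einf = (\<zeta> *v einf) $ None *\<^sub>R einf"
        using lightcone_orthogonal_einf[OF lightcone_Gset[OF z' einf_lightcone]] by blast
      then have "\<gamma> *v (\<zeta> *v einf) = (\<zeta> *v einf) $ None *\<^sub>R (\<gamma> *v einf)"
        by (metis matrix_vector_mult_scaleR)
      then show ?thesis using fix_inf[OF g] by (simp add: matrix_vector_mul_assoc [symmetric])
    qed
    obtain \<epsilon> where e: "\<epsilon> > 0"
      "\<And>H x. H \<ge> 4 / \<epsilon> \<Longrightarrow> norm x \<le> 1 \<Longrightarrow> \<exists>\<gamma>\<in>\<Gamma>. \<exists>\<xi>\<in>\<Xi>. let w = (\<gamma> ** \<xi>) *v einf; h = w $ Some None in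
       \<epsilon> / 4 \<le> h \<and> h \<le> H \<and> h * H * norm (pos w - x) ^ 2 \<le> 2"
      using dirichlet_cusp by blast
    from e(2)[of "4 / \<epsilon>" 0] obtain \<gamma> \<zeta> where "\<gamma> \<in> \<Gamma>" "\<zeta> \<in> \<Xi>"
      "\<epsilon> / 4 \<le> ((\<gamma> ** \<zeta>) *v einf) $ Some None"
      unfolding Let_def by auto
    then show False using all_inf e(1) by simp
  qed
  then show thesis using that by blast
qed

text \<open>Only the orbit of \<infinity> is recorded, not the cusps belonging to other elements of
  \<Xi>.\<close>

definition cusps :: "real \<Rightarrow> (real^'m) set" where
  "cusps C = {pos (\<gamma> *v einf) | \<gamma>. \<gamma> \<in> \<Gamma> \<and> 0 < (\<gamma> *v einf) $ Some None \<and> (\<gamma> *v einf) $ Some None \<le> C}"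

lemma cusps_mono: "C \<le> D \<Longrightarrow> cusps C \<subseteq> cusps D"
  unfolding cusps_def by fastforce

text \<open>Seen from \<gamma>\<xi>, the points \<open>umat x *v z0\<close> with x in the lattice of
  \<xi> lie on one horizontal level. Those at distance comparable to k = sqrt (H / h) from the
  preimage of \<infinity> number at least (2k)^(n-1) = (r H)^(n-1); by \<open>image_height\<close>
  their images have height O(H) and lie within r of \<gamma>\<xi>\<infinity>.\<close>

lemma local_count:
  assumes R0: "R0 \<ge> 1" and dense: "\<And>x. \<exists>y\<in>cusp_lattice \<Gamma> \<xi>. dist x y \<le> R0"
    and xi: "\<xi> \<in> \<Xi>" and g0: "\<gamma>0 \<in> \<Gamma>" "(matrix_inv \<xi> *v (\<gamma>0 *v einf)) $ Some None > 0"
    and g: "\<gamma> \<in> \<Gamma>" and h: "h = ((\<gamma> ** \<xi>) *v einf) $ Some None" "0 < h" "h \<le> H"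
    and r: "r = 2 / (h * sqrt (H / h))"
  shows "at_least (cusps (32 * (matrix_inv \<xi> *v (\<gamma>0 *v einf)) $ Some None * R0 ^ 2 * H)
      \<inter> cball (pos ((\<gamma> ** \<xi>) *v einf)) r) ((r * H) ^ CARD('m))"
proof -
  define p where "p = \<gamma> ** \<xi>"
  define w where "w = p *v einf"
  define q where "q = matrix_inv p *v einf"
  define z0 where "z0 = matrix_inv \<xi> *v (\<gamma>0 *v einf)"
  define c where "c = z0 $ Some None"
  define b where "b = pos z0 - pos q"
  define k where "k = sqrt (H / h)"
  \<comment> \<open>Inner radius R1 / 4 = 2 R0 k: at least 2k, which bounds the distance of the
    images, and wide enough to leave (2k)^(n-1) points at covering radius R0.\<close>
  define R1 where "R1 = 8 * R0 * k"
  define F where "F = {x \<in> cusp_lattice \<Gamma> \<xi>. R1 / 4 \<le> norm (x + b) \<and> norm (x + b) \<le> R1}"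
  have xi': "\<xi> \<in> Gset" using xi Xi(2) by auto
  have p: "p \<in> Gset" unfolding p_def using g Gamma_Gset xi' by (intro Gset_mult) auto
  have z0: "z0 \<in> lightcone" "z0 $ Some None > 0"
    using g0 Gamma_Gset xi' by (auto simp: z0_def intro!: lightcone_Gset Gset_inv)
  have wh: "w $ Some None = h" by (simp add: w_def p_def h)
  have k: "k \<ge> 1" "k ^ 2 = H / h" using h(2,3) by (simp_all add: k_def)
  have kH: "h * k ^ 2 = H" using k(2) h(2) by simp
  have R1: "R1 > 0" "R1 \<ge> 8 * R0" using k(1) R0 by (simp_all add: R1_def)
  have rk: "r = 2 / (h * k)" by (simp add: r k_def)
  obtain e :: "real^'m" where e: "norm e = 1" using vector_choose_size[of 1] by auto
  \<comment> \<open>The ball of radius R1 / 4 about this centre, enlarged by R0 \<le> R1 / 8, stays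
    in the annulus, since 5/8 - 3/8 = 1/4 and 5/8 + 3/8 = 1.\<close>
  define a where "a = (5 / 8 * R1) *\<^sub>R e - b"
  have "at_least F ((R1 / 4 / R0) ^ DIM(real^'m))"
  proof (rule at_least_of_dense[where a = a])
    fix z assume "z \<in> cball a (R1 / 4)"
    then have z: "norm (z - a) \<le> R1 / 4" by (simp add: dist_norm norm_minus_commute)
    obtain x where x: "x \<in> cusp_lattice \<Gamma> \<xi>" "dist z x \<le> R0" using dense by blast
    have "norm (x - a) \<le> norm (z - a) + dist z x"
      unfolding dist_norm by (metis add.commute diff_add_cancel add_diff_eq norm_minus_commute norm_triangle_ineq)
    then have xa: "norm ((x + b) - (5 / 8 * R1) *\<^sub>R e) \<le> 3 / 8 * R1"
      using z x(2) R1(2) by (simp add: a_def algebra_simps)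
    have n: "norm ((5 / 8 * R1) *\<^sub>R e) = 5 / 8 * R1" using e R1 by simp
    have "norm (x + b) \<le> R1"
      using norm_triangle_sub[of "x + b" "(5 / 8 * R1) *\<^sub>R e"] xa n by linarith
    moreover have "norm (x + b) \<ge> R1 / 4"
      using norm_triangle_sub[of "(5 / 8 * R1) *\<^sub>R e" "x + b"] xa n norm_minus_commute[of "x + b"] by (simp add: field_simps)
    ultimately show "\<exists>x\<in>F. dist z x \<le> R0" using x by (auto simp: F_def)
  qed (use R1 R0 in auto)
  moreover have "R1 / 4 / R0 = r * H"
  proof -
    have "R1 / 4 / R0 = 2 * k" using R0 by (simp add: R1_def)
    moreover have "r * H = 2 * k"
      using h(2) k(1) unfolding rk kH [symmetric] by (simp add: power2_eq_square)
    ultimately show ?thesis by simp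
  qed
  ultimately have count: "at_least F ((r * H) ^ CARD('m))" by simp
  define f where "f x = pos (p *v (umat x *v z0))" for x
  have main: "umat x *v z0 \<in> lightcone \<and> (umat x *v z0) $ Some None > 0
      \<and> pos (umat x *v z0) = pos z0 + x \<and> (p *v (umat x *v z0)) $ Some None > 0
      \<and> f x \<in> cusps (32 * c * R0 ^ 2 * H) \<and> f x \<in> cball (pos w) r" if x: "x \<in> F" for x
  proof -
    define z where "z = umat x *v z0"
    define d where "d = norm (x + b)"
    have d: "R1 / 4 \<le> d" "d \<le> R1" "d > 0" using x R1 by (auto simp: F_def d_def)
    have z: "z \<in> lightcone" "z $ Some None = c" "pos z = pos z0 + x"
      using umat_lightcone[OF z0] by (simp_all add: z_def c_def)
    have cp: "c > 0" using z0 by (simp add: c_def)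
    have dz: "norm (pos z - pos (matrix_inv p *v einf)) = d"
      by (simp add: z(3) d_def b_def q_def algebra_simps)
    have wpos: "(p *v einf) $ Some None > 0" using wh h by (simp add: w_def)
    have zpos: "z $ Some None > 0" using z(2) cp by simp
    note I = image_height[OF p wpos z(1) zpos, unfolded dz, folded w_def, unfolded wh z(2)]
    have pos1: "(p *v z) $ Some None > 0" unfolding I(1) using cp h(2) d(3) by simp
    have "(p *v z) $ Some None \<le> c * h * R1 ^ 2 / 2"
      unfolding I(1) using cp h(2) d by (intro divide_right_mono mult_left_mono power_mono) auto
    also have "\<dots> = 32 * c * R0 ^ 2 * (h * k ^ 2)" by (simp add: R1_def power_mult_distrib)
    finally have hb: "(p *v z) $ Some None \<le> 32 * c * R0 ^ 2 * H" by (simp add: kH)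
    \<comment> \<open>The points found near \<gamma>\<xi>\<infinity> belong to the orbit of
      \<infinity> itself, because z0 comes from \<gamma>0.\<close>
    have "\<gamma> ** (\<xi> ** umat x ** matrix_inv \<xi>) ** \<gamma>0 \<in> \<Gamma>"
      using x g g0(1) by (auto simp: F_def cusp_lattice_def intro!: Gamma_mult)
    moreover have "(\<gamma> ** (\<xi> ** umat x ** matrix_inv \<xi>) ** \<gamma>0) *v einf = p *v z"
      by (simp add: p_def z_def z0_def matrix_vector_mul_assoc [symmetric])
    ultimately have "f x \<in> cusps (32 * c * R0 ^ 2 * H)"
      using pos1 hb unfolding cusps_def f_def z_def [symmetric] by (metis (mono_tags, lifting) mem_Collect_eq)
    moreover have "f x \<in> cball (pos w) r"
    proof -
      have "norm (f x - pos w) = 2 / (h * d)" using I(2)[OF d(3)] by (simp add: f_def z_def)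
      also have "\<dots> \<le> 2 / (h * (2 * k))"
      proof -
        have "1 * k \<le> R0 * k" using R0 k(1) by (intro mult_right_mono) auto
        then have "2 * k \<le> d" using d(1) by (simp add: R1_def)
        then show ?thesis using h(2) k(1) by (intro divide_left_mono mult_left_mono) auto
      qed
      also have "\<dots> \<le> r" unfolding rk using h(2) k(1) by (intro divide_left_mono mult_left_mono) auto
      finally show ?thesis by (simp add: dist_norm norm_minus_commute)
    qed
    ultimately show ?thesis using z zpos pos1 by (simp add: z_def)
  qed
  have "inj_on f F"
  proof (rule inj_onI)
    fix x y assume "x \<in> F" "y \<in> F" and eq: "f x = f y"
    note mx = main[OF \<open>x \<in> F\<close>, THEN conjunct1] main[OF \<open>x \<in> F\<close>, THEN conjunct2, THEN conjunct1]
      main[OF \<open>x \<in> F\<close>, THEN conjunct2, THEN conjunct2, THEN conjunct2, THEN conjunct1]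
    note my = main[OF \<open>y \<in> F\<close>, THEN conjunct1] main[OF \<open>y \<in> F\<close>, THEN conjunct2, THEN conjunct1]
      main[OF \<open>y \<in> F\<close>, THEN conjunct2, THEN conjunct2, THEN conjunct2, THEN conjunct1]
    have "pos (umat x *v z0) = pos (umat y *v z0)"
      by (rule pos_image_inj[OF Gset_preserves[OF p] mx my lightcone_Gset[OF p mx(1)]
            lightcone_Gset[OF p my(1)] eq[unfolded f_def]])
    then show "x = y" using main[OF \<open>x \<in> F\<close>] main[OF \<open>y \<in> F\<close>] by simp
  qed
  moreover have "f ` F \<subseteq> cusps (32 * c * R0 ^ 2 * H) \<inter> cball (pos w) r" using main by blast
  ultimately have "at_least (cusps (32 * c * R0 ^ 2 * H) \<inter> cball (pos w) r) ((r * H) ^ CARD('m))"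
    by (rule at_least_image[OF count])
  then show ?thesis unfolding c_def z0_def w_def p_def .
qed

text \<open>Dirichlet puts each x of the small ball within sqrt (2 / (h H)) of a cusp, hence inside
  the ball of radius r = 2 / sqrt (h H) where \<open>local_count\<close> applies;
  \<open>at_least_of_local\<close> adds these up. The maximum over \<Xi> makes C uniform.\<close>

lemma cusp_count:
  obtains C where "C > 0" "\<And>\<delta>. 0 < \<delta> \<Longrightarrow> \<delta> \<le> 1 \<Longrightarrow>
    \<exists>H0>0. \<forall>H\<ge>H0. at_least (cusps (C * H) \<inter> cball 0 (3 * \<delta>)) ((\<delta> * H / 5) ^ CARD('m))"
proof -
  obtain R0 where R0: "R0 \<ge> 1" "\<And>\<xi> x. \<xi> \<in> \<Xi> \<Longrightarrow> \<exists>y\<in>cusp_lattice \<Gamma> \<xi>. dist x y \<le> R0"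
    using uniform_radius by blast
  have "\<forall>\<xi>\<in>\<Xi>. \<exists>\<gamma>. \<gamma> \<in> \<Gamma> \<and> (matrix_inv \<xi> *v (\<gamma> *v einf)) $ Some None > 0"
    using cusp_orbit_nontrivial by metis
  then obtain g0 where g0: "\<And>\<xi>. \<xi> \<in> \<Xi> \<Longrightarrow> g0 \<xi> \<in> \<Gamma>"
    "\<And>\<xi>. \<xi> \<in> \<Xi> \<Longrightarrow> (matrix_inv \<xi> *v (g0 \<xi> *v einf)) $ Some None > 0" by metis
  define c where "c \<xi> = (matrix_inv \<xi> *v (g0 \<xi> *v einf)) $ Some None" for \<xi>
  define C where "C = 32 * Max (c ` \<Xi>) * R0 ^ 2"
  have cmax: "c \<xi> \<le> Max (c ` \<Xi>)" if "\<xi> \<in> \<Xi>" for \<xi> using that Xi(1) by simp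
  have "0 < Max (c ` \<Xi>)" using cmax[OF Xi(3)] g0(2)[OF Xi(3)] by (simp add: c_def)
  then have C: "C > 0" using R0 by (simp add: C_def)
  obtain \<epsilon> where e: "\<epsilon> > 0"
    "\<And>H x. H \<ge> 4 / \<epsilon> \<Longrightarrow> norm x \<le> 1 \<Longrightarrow> \<exists>\<gamma>\<in>\<Gamma>. \<exists>\<xi>\<in>\<Xi>. let w = (\<gamma> ** \<xi>) *v einf; h = w $ Some None in
     \<epsilon> / 4 \<le> h \<and> h \<le> H \<and> h * H * norm (pos w - x) ^ 2 \<le> 2"
    using dirichlet_cusp by blast
  have "\<exists>H0>0. \<forall>H\<ge>H0. at_least (cusps (C * H) \<inter> cball 0 (3 * \<delta>)) ((\<delta> * H / 5) ^ CARD('m))"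
    if d: "0 < \<delta>" "\<delta> \<le> 1" for \<delta>
  proof (intro exI conjI allI impI)
    \<comment> \<open>The first term allows Dirichlet approximation, the second gives r^2 = 4 / (h
      H) \<le> \<delta>^2, because h \<ge> \<epsilon> / 4.\<close>
    let ?H0 = "max (4 / \<epsilon>) (16 / (\<epsilon> * \<delta> ^ 2))"
    show "?H0 > 0" using e(1) by (simp add: less_max_iff_disj)
    fix H assume "?H0 \<le> H"
    then have H: "4 / \<epsilon> \<le> H" "16 / (\<epsilon> * \<delta> ^ 2) \<le> H" by auto
    then have Hp: "H > 0" using e(1) by (meson divide_pos_pos less_le_trans zero_less_numeral)
    have "at_least (cusps (C * H) \<inter> cball 0 (3 * \<delta>)) ((\<delta> * H / 5) ^ DIM(real^'m))"
    proof (rule at_least_of_local)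
      fix x :: "real^'m" assume "x \<in> cball 0 \<delta>"
      then have x: "norm x \<le> 1" using d by simp
      obtain \<gamma> \<xi> where gx: "\<gamma> \<in> \<Gamma>" "\<xi> \<in> \<Xi>" and
        hh: "\<epsilon> / 4 \<le> ((\<gamma> ** \<xi>) *v einf) $ Some None" "((\<gamma> ** \<xi>) *v einf) $ Some None \<le> H"
          "((\<gamma> ** \<xi>) *v einf) $ Some None * H * norm (pos ((\<gamma> ** \<xi>) *v einf) - x) ^ 2 \<le> 2"
        using e(2)[OF H(1) x] unfolding Let_def by blast
      define w where "w = (\<gamma> ** \<xi>) *v einf"
      define h where "h = w $ Some None"
      define r where "r = 2 / (h * sqrt (H / h))"
      have h: "h > 0" "h \<le> H" "\<epsilon> / 4 \<le> h" using hh e(1) by (simp_all add: h_def w_def)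
      have r2: "r ^ 2 = 4 / (h * H)"
        using h Hp by (simp add: r_def power_divide power_mult_distrib) (simp add: power2_eq_square)
      have rp: "r > 0" using h Hp by (simp add: r_def)
      have "r ^ 2 \<le> \<delta> ^ 2"
      proof -
        have "16 \<le> H * (\<epsilon> * \<delta> ^ 2)" using H(2) e(1) d by (simp add: field_simps)
        also have "\<dots> = 4 * (H * (\<epsilon> / 4) * \<delta> ^ 2)" by simp
        also have "\<dots> \<le> 4 * (H * h * \<delta> ^ 2)"
          using h(3) Hp by (intro mult_left_mono mult_right_mono) auto
        finally show ?thesis using h Hp by (simp add: r2 field_simps)
      qed
      then have rd: "r \<le> \<delta>" using d(1) by (elim power2_le_imp_le) simp
      have "norm (pos w - x) ^ 2 < r ^ 2"
      proof -
        have "h * H * norm (pos w - x) ^ 2 \<le> 2" using hh(3) by (simp add: h_def w_def)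
        then have "h * H * norm (pos w - x) ^ 2 < 4" by simp
        then show ?thesis using h Hp by (simp add: r2 field_simps)
      qed
      then have xb: "x \<in> ball (pos w) r" using rp by (simp add: dist_norm power_less_imp_less_base)
      have "at_least (cusps (32 * c \<xi> * R0 ^ 2 * H) \<inter> cball (pos w) r) ((r * H) ^ CARD('m))"
        unfolding w_def c_def
      proof (rule local_count[OF R0(1) R0(2) gx(2) g0(1) g0(2) gx(1) _ _ _ r_def])
        show "h = ((\<gamma> ** \<xi>) *v einf) $ Some None" by (simp add: h_def w_def)
      qed (use h gx in auto)
      moreover have "32 * c \<xi> * R0 ^ 2 * H \<le> C * H"
        unfolding C_def using cmax[OF gx(2)] Hp by (intro mult_right_mono) auto
      ultimately have "at_least (cusps (C * H) \<inter> cball (pos w) r) ((r * H) ^ DIM(real^'m))"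
        by (elim at_least_mono) (use cusps_mono in blast, simp)
      then show "\<exists>y r. 0 < r \<and> r \<le> \<delta> \<and> x \<in> ball y r \<and>
          at_least (cusps (C * H) \<inter> cball y r) ((r * H) ^ DIM(real^'m))"
        using rp rd xb by blast
    qed (use d Hp in auto)
    then show "at_least (cusps (C * H) \<inter> cball 0 (3 * \<delta>)) ((\<delta> * H / 5) ^ CARD('m))" by simp
  qed
  then show thesis using that C by blast
qed

section \<open>The lattice at infinity and the window of heights\<close>

lemma cusp_lattice_one: "cusp_lattice \<Gamma> (mat 1) = {x. umat x \<in> \<Gamma>}"
proof -
  have "matrix_inv (mat 1) = (mat 1 :: 'm gmat)"
    using preserves_bf_inv(1)[OF Gset_preserves[OF Gamma_Gset[OF Gamma_one]]] by simp
  then show ?thesis by (simp add: cusp_lattice_def)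
qed

text \<open>The displacement bound for p = 1, where s = 1, shows u(x) to be close to the identity
  for short x; discreteness does the rest.\<close>

lemma cusp_lattice_separated:
  obtains \<eta> where "\<eta> > 0" "\<And>x. umat x \<in> \<Gamma> \<Longrightarrow> norm x < \<eta> \<Longrightarrow> x = 0"
proof -
  obtain e where e: "e > 0" "\<And>g. g \<in> \<Gamma> \<Longrightarrow> dist g (mat 1) < e \<Longrightarrow> g = mat 1"
    using Gamma_discrete Gamma_one by (auto simp: discrete_set_def)
  define N where "N = real CARD('m idx) ^ 2"
  have N: "N > 0" by (simp add: N_def)
  define \<eta> where "\<eta> = min 1 (e / (3 * N))"
  have "x = 0" if x: "umat x \<in> \<Gamma>" "norm x < \<eta>" for x
  proof -
    have one: "mat 1 \<in> (Gset :: 'm gmat set)" using Gamma_one Gamma_Gset by blast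
    have inv: "matrix_inv (mat 1) = (mat 1 :: 'm gmat)"
      using preserves_bf_inv(1)[OF Gset_preserves[OF one]] by simp
    have "norm (umat x - mat 1) \<le> N * (2 * norm x + norm x ^ 2 / 2)"
      unfolding N_def
    proof (rule norm_matrix_le)
      fix v :: "real^'m idx"
      have "(umat x - mat 1) *v v = umat x *v v - v" by (simp add: matrix_vector_mult_diff_rdistrib)
      then show "norm ((umat x - mat 1) *v v) \<le> (2 * norm x + norm x ^ 2 / 2) * norm v"
        using conj_unipotent_bound[OF one, of x v] by (simp add: inv)
    qed
    also have "\<dots> \<le> N * (3 * norm x)"
    proof (intro mult_left_mono)
      have "norm x * norm x \<le> 1 * norm x" using x(2) by (intro mult_right_mono) (auto simp: \<eta>_def)
      moreover have "0 \<le> norm x" by simp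
      ultimately show "2 * norm x + norm x ^ 2 / 2 \<le> 3 * norm x"
        unfolding power2_eq_square by linarith
    qed (use N in simp)
    also have "\<dots> < e" using x(2) N by (simp add: \<eta>_def field_simps)
    finally have "umat x = umat 0" using e(2)[OF x(1)] by (simp add: dist_norm umat_0)
    then show "x = 0" by (rule umat_inj)
  qed
  then show thesis using that[of \<eta>] e(1) N by (auto simp: \<eta>_def)
qed

text \<open>Translating a cusp by the lattice at infinity does not change its height but moves its
  distance to \<open>\<gamma>\<^sup>-\<^sup>1\<infinity>\<close>; this adjusts the height of its image under \<open>\<gamma>\<close> to the prescribed window,
  however narrow the window is.\<close>

lemma count_near_cusp:
  assumes A: "0 < A1" "A1 < A2" "0 < A3"
  shows "\<exists>T>0. \<exists>\<Upsilon>>0. \<forall>t\<ge>T. \<forall>\<gamma>\<in>\<Gamma>. \<forall>h. h = (\<gamma> *v einf) $ Some None \<and> h > 0 \<longrightarrow>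
    at_least {pos (\<gamma>' *v einf) | \<gamma>'. \<gamma>' \<in> \<Gamma> \<and> (\<gamma>' *v einf) $ Some None > 0 \<and>
        A1 * exp t * h \<le> (\<gamma>' *v einf) $ Some None \<and> (\<gamma>' *v einf) $ Some None \<le> A2 * exp t * h \<and>
        norm (pos (\<gamma>' *v einf) - pos (\<gamma> *v einf)) \<le> A3 / h}
      (\<Upsilon> * exp (real CARD('m) * t))"
proof -
  obtain R0 where R0: "R0 \<ge> 1" "\<And>\<xi> x. \<xi> \<in> \<Xi> \<Longrightarrow> \<exists>y\<in>cusp_lattice \<Gamma> \<xi>. dist x y \<le> R0"
    using uniform_radius by blast
  have dense: "\<exists>y. umat y \<in> \<Gamma> \<and> dist x y \<le> R0" for x
    using R0(2)[OF Xi(3), of x] by (auto simp: cusp_lattice_one)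
  obtain \<eta> where eta: "\<eta> > 0" "\<And>x. umat x \<in> \<Gamma> \<Longrightarrow> norm x < \<eta> \<Longrightarrow> x = 0"
    using cusp_lattice_separated by blast
  obtain C where C: "C > 0" "\<And>\<delta>. 0 < \<delta> \<Longrightarrow> \<delta> \<le> 1 \<Longrightarrow>
    \<exists>H0>0. \<forall>H\<ge>H0. at_least (cusps (C * H) \<inter> cball 0 (3 * \<delta>)) ((\<delta> * H / 5) ^ CARD('m))"
    using cusp_count by blast
  \<comment> \<open>Two points of the ball of radius 3\<delta> differ by less than \<eta>, so
    distinct ones are never lattice translates of each other.\<close>
  define \<delta> where "\<delta> = min 1 (\<eta> / 7)"
  have delta: "\<delta> > 0" "\<delta> \<le> 1" "6 * \<delta> < \<eta>" using eta(1) by (auto simp: \<delta>_def)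
  obtain H0 where H0: "H0 > 0" "\<And>H. H \<ge> H0 \<Longrightarrow>
      at_least (cusps (C * H) \<inter> cball 0 (3 * \<delta>)) ((\<delta> * H / 5) ^ CARD('m))"
    using C(2)[OF delta(1,2)] by blast
  \<comment> \<open>Image heights are proportional to the squared distance, so the window of ratio
    A2 / A1 allows distances of ratio q.\<close>
  define q where "q = sqrt (A2 / A1)"
  have q: "q > 1" "q ^ 2 = A2 / A1" using A by (simp_all add: q_def)
  \<comment> \<open>The first term makes the annulus from R to q R at least 2 R0 thick, the second
    brings the images within A3 / h.\<close>
  define Rm where "Rm = max (2 * R0 / (q - 1)) (2 / A3)"
  have Rm: "2 * R0 / (q - 1) \<le> Rm" "2 / A3 \<le> Rm" "Rm > 0"
    using A by (simp_all add: Rm_def less_max_iff_disj)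
  \<comment> \<open>Chosen so that orbit points of height at most C H, with H = \<kappa> exp t,
    require a distance R \<ge> Rm.\<close>
  define \<kappa> where "\<kappa> = 2 * A1 / (C * Rm ^ 2)"
  have kap: "\<kappa> > 0" using A C(1) Rm(3) by (simp add: \<kappa>_def)
  define T where "T = max 1 (ln (H0 / \<kappa>))"
  define \<Upsilon> where "\<Upsilon> = (\<delta> * \<kappa> / 5) ^ CARD('m)"
  have "at_least {pos (\<gamma>' *v einf) | \<gamma>'. \<gamma>' \<in> \<Gamma> \<and> (\<gamma>' *v einf) $ Some None > 0 \<and>
        A1 * exp t * h \<le> (\<gamma>' *v einf) $ Some None \<and> (\<gamma>' *v einf) $ Some None \<le> A2 * exp t * h \<and>
        norm (pos (\<gamma>' *v einf) - pos (\<gamma> *v einf)) \<le> A3 / h}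
      (\<Upsilon> * exp (real CARD('m) * t))" (is "at_least ?S _")
    if t: "t \<ge> T" and g: "\<gamma> \<in> \<Gamma>" and h: "h = (\<gamma> *v einf) $ Some None" "h > 0" for t \<gamma> h
  proof -
    define H where "H = \<kappa> * exp t"
    define X where "X = cusps (C * H) \<inter> cball 0 (3 * \<delta>)"
    have "H0 / \<kappa> = exp (ln (H0 / \<kappa>))" using H0(1) kap by simp
    also have "\<dots> \<le> exp t" using t by (simp add: T_def)
    finally have "H0 \<le> H" using kap by (simp add: H_def field_simps)
    then have "at_least X ((\<delta> * H / 5) ^ CARD('m))" unfolding X_def by (rule H0(2))
    moreover have "(\<delta> * H / 5) ^ CARD('m) = \<Upsilon> * exp (real CARD('m) * t)"
    proof -
      have "exp (real CARD('m) * t) = exp t ^ CARD('m)" by (rule exp_of_nat_mult)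
      then show ?thesis unfolding \<Upsilon>_def H_def by (simp add: power_mult_distrib [symmetric] mult.assoc)
    qed
    ultimately have count: "at_least X (\<Upsilon> * exp (real CARD('m) * t))" by simp
    have gG: "\<gamma> \<in> Gset" using g Gamma_Gset by blast
    define y where "y = pos (matrix_inv \<gamma> *v einf)"
    obtain e :: "real^'m" where e: "norm e = 1" using vector_choose_size[of 1] by auto
    \<comment> \<open>Here g represents the counted cusp x and l is the translation applied next.
      The expressions in \<open>x + l - y\<close> are the height and the distance that
      \<open>image_height\<close> gives for the image under \<gamma>.\<close>
    define Q where "Q x g l \<longleftrightarrow> g \<in> \<Gamma> \<and> umat l \<in> \<Gamma> \<and> pos (g *v einf) = x \<and> (g *v einf) $ Some None > 0 \<and>
        A1 * exp t * h \<le> (g *v einf) $ Some None * h * norm (x + l - y) ^ 2 / 2 \<and>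
        (g *v einf) $ Some None * h * norm (x + l - y) ^ 2 / 2 \<le> A2 * exp t * h \<and>
        norm (x + l - y) > 0 \<and> 2 / (h * norm (x + l - y)) \<le> A3 / h" for x g l
    have "\<forall>x\<in>X. \<exists>g l. Q x g l"
    proof
      fix x assume "x \<in> X"
      then obtain g where gg: "g \<in> \<Gamma>" "pos (g *v einf) = x" "(g *v einf) $ Some None > 0"
        "(g *v einf) $ Some None \<le> C * H" by (auto simp: X_def cusps_def)
      define h2 where "h2 = (g *v einf) $ Some None"
      have h2: "h2 > 0" "h2 \<le> C * H" using gg by (simp_all add: h2_def)
      \<comment> \<open>The distance from y at which the image has exactly the lowest admissible
        height A1 exp t h.\<close>
      define R where "R = sqrt (2 * A1 * exp t / h2)"
      have R2: "R ^ 2 = 2 * A1 * exp t / h2" using A h2 by (simp add: R_def)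
      have "Rm ^ 2 \<le> 2 * A1 * exp t / h2"
      proof -
        have "h2 * Rm ^ 2 \<le> (C * H) * Rm ^ 2" using h2 by (intro mult_right_mono) auto
        also have "\<dots> = 2 * A1 * exp t" using C(1) Rm(3) by (simp add: H_def \<kappa>_def)
        finally show ?thesis using h2 by (simp add: field_simps)
      qed
      then have RR: "Rm \<le> R" unfolding R_def by (rule real_le_rsqrt)
      then have Rp: "R > 0" using Rm(3) by linarith
      have R0q: "2 * R0 \<le> R * (q - 1)"
      proof -
        have "2 * R0 = 2 * R0 / (q - 1) * (q - 1)" using q(1) by simp
        also have "\<dots> \<le> R * (q - 1)" using Rm(1) RR q(1) by (intro mult_right_mono) auto
        finally show ?thesis .
      qed
      \<comment> \<open>The offset from y to the middle of the annulus; a lattice translate of x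
        within R0 of this target stays in the annulus.\<close>
      define a where "a = (R * (1 + q) / 2) *\<^sub>R e"
      have na: "norm a = R * (1 + q) / 2" using e Rp q(1) by (simp add: a_def)
      obtain l where l: "umat l \<in> \<Gamma>" "dist (y + a - x) l \<le> R0" using dense by blast
      define d where "d = norm (x + l - y)"
      have ad: "norm (a - (x + l - y)) \<le> R0" using l(2) by (simp add: dist_norm algebra_simps)
      have dR: "R \<le> d"
        using norm_triangle_sub[of a "x + l - y"] ad na R0q by (simp add: d_def field_simps)
      have dq: "d \<le> q * R"
        using norm_triangle_sub[of "x + l - y" a] ad na R0q norm_minus_commute[of a "x + l - y"]
        by (simp add: d_def field_simps)
      have dp: "d > 0" using dR Rp by linarith
      have 1: "A1 * exp t * h \<le> h2 * h * d ^ 2 / 2"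
      proof -
        have "A1 * exp t * h = h2 * h * R ^ 2 / 2" using h2 by (simp add: R2)
        also have "\<dots> \<le> h2 * h * d ^ 2 / 2"
          using h2 h Rp dR by (intro divide_right_mono mult_left_mono power_mono) auto
        finally show ?thesis .
      qed
      have 2: "h2 * h * d ^ 2 / 2 \<le> A2 * exp t * h"
      proof -
        have "h2 * h * d ^ 2 / 2 \<le> h2 * h * (q * R) ^ 2 / 2"
          using h2 h dp dq by (intro divide_right_mono mult_left_mono power_mono) auto
        also have "\<dots> = A2 * exp t * h" using h2 A by (simp add: power_mult_distrib R2 q(2))
        finally show ?thesis .
      qed
      have 3: "2 / (h * d) \<le> A3 / h"
      proof -
        have "2 / A3 \<le> d" using Rm(2) RR dR by linarith
        then have "2 \<le> A3 * d" using A(3) by (simp add: field_simps)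
        then show ?thesis using h(2) dp by (simp add: field_simps)
      qed
      have "Q x g l" using gg l(1) 1 2 3 dp by (simp add: Q_def h2_def d_def)
      then show "\<exists>g l. Q x g l" by blast
    qed
    then obtain g l where "\<And>x. x \<in> X \<Longrightarrow> Q x (g x) (l x)" by metis
    then have gl: "\<And>x. x \<in> X \<Longrightarrow> g x \<in> \<Gamma>" "\<And>x. x \<in> X \<Longrightarrow> umat (l x) \<in> \<Gamma>"
      "\<And>x. x \<in> X \<Longrightarrow> pos (g x *v einf) = x" "\<And>x. x \<in> X \<Longrightarrow> (g x *v einf) $ Some None > 0"
      "\<And>x. x \<in> X \<Longrightarrow> A1 * exp t * h \<le> (g x *v einf) $ Some None * h * norm (x + l x - y) ^ 2 / 2"
      "\<And>x. x \<in> X \<Longrightarrow> (g x *v einf) $ Some None * h * norm (x + l x - y) ^ 2 / 2 \<le> A2 * exp t * h"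
      "\<And>x. x \<in> X \<Longrightarrow> norm (x + l x - y) > 0" "\<And>x. x \<in> X \<Longrightarrow> 2 / (h * norm (x + l x - y)) \<le> A3 / h"
      by (simp_all add: Q_def)
    define z where "z x = umat (l x) *v (g x *v einf)" for x
    define f where "f x = pos (\<gamma> *v z x)" for x
    have z: "z x \<in> lightcone" "z x $ Some None = (g x *v einf) $ Some None" "pos (z x) = x + l x"
      if x: "x \<in> X" for x
    proof -
      have "g x *v einf \<in> lightcone" using gl(1)[OF x] Gamma_Gset by (intro lightcone_Gset einf_lightcone) auto
      note U = umat_lightcone[OF this gl(4)[OF x], of "l x"]
      show "z x \<in> lightcone" "z x $ Some None = (g x *v einf) $ Some None" "pos (z x) = x + l x"
        using U gl(3)[OF x] by (simp_all add: z_def)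
    qed
    have zpos: "z x $ Some None > 0" if x: "x \<in> X" for x using z(2)[OF x] gl(4)[OF x] by simp
    have wpos: "(\<gamma> *v einf) $ Some None > 0" using h by simp
    have I: "(\<gamma> *v z x) $ Some None = (g x *v einf) $ Some None * h * norm (x + l x - y) ^ 2 / 2"
      "norm (f x - pos (\<gamma> *v einf)) = 2 / (h * norm (x + l x - y))" if x: "x \<in> X" for x
    proof -
      note J = image_height[OF gG wpos z(1)[OF x] zpos[OF x], folded y_def h(1), unfolded z(2,3)[OF x]]
      show "(\<gamma> *v z x) $ Some None = (g x *v einf) $ Some None * h * norm (x + l x - y) ^ 2 / 2"
        by (rule J(1))
      show "norm (f x - pos (\<gamma> *v einf)) = 2 / (h * norm (x + l x - y))"
        unfolding f_def using J(2) gl(7)[OF x] by blast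
    qed
    have fpos: "(\<gamma> *v z x) $ Some None > 0" if x: "x \<in> X" for x
      unfolding I(1)[OF x] using gl(4)[OF x] gl(7)[OF x] h(2) by simp
    show ?thesis
    proof (rule at_least_image[OF count])
      show "inj_on f X"
      proof (rule inj_onI)
        fix a b assume ab: "a \<in> X" "b \<in> X" and eq: "f a = f b"
        have "pos (z a) = pos (z b)"
          by (rule pos_image_inj[OF Gset_preserves[OF gG] z(1)[OF ab(1)] zpos[OF ab(1)] fpos[OF ab(1)]
                z(1)[OF ab(2)] zpos[OF ab(2)] fpos[OF ab(2)] lightcone_Gset[OF gG z(1)[OF ab(1)]]
                lightcone_Gset[OF gG z(1)[OF ab(2)]] eq[unfolded f_def]])
        \<comment> \<open>Equal images force equal translated points, so a - b lies in the lattice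
          at infinity and is shorter than \<eta>.\<close>
        then have s: "a + l a = b + l b" using z(3) ab by simp
        have "umat (l b) ** matrix_inv (umat (l a)) \<in> \<Gamma>"
          using gl(2) ab by (intro Gamma_mult Gamma_inv) auto
        moreover have "matrix_inv (umat (l a)) = umat (- l a)"
        proof -
          have "matrix_inv (umat (l a)) ** (umat (l a) ** umat (- l a)) = matrix_inv (umat (l a))"
            by (simp add: umat_add umat_0)
          then show ?thesis
            by (simp add: matrix_mul_assoc preserves_bf_inv[OF umat_preserves])
        qed
        ultimately have "umat (l b - l a) \<in> \<Gamma>" by (simp add: umat_add)
        moreover have "l b - l a = a - b" using s by (simp add: algebra_simps)
        moreover have "norm (a - b) < \<eta>"
        proof -
          have "norm a \<le> 3 * \<delta>" "norm b \<le> 3 * \<delta>" using ab by (auto simp: X_def)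
          then show ?thesis using norm_triangle_ineq4[of a b] delta(3) by linarith
        qed
        ultimately show "a = b" using eta(2)[of "a - b"] by simp
      qed
      show "f ` X \<subseteq> ?S"
      proof
        fix b assume "b \<in> f ` X"
        then obtain x where x: "x \<in> X" "b = f x" by blast
        let ?g = "\<gamma> ** umat (l x) ** g x"
        have "?g \<in> \<Gamma>" using gl(1,2)[OF x(1)] g by (intro Gamma_mult)
        moreover have "?g *v einf = \<gamma> *v z x" by (simp add: z_def matrix_vector_mul_assoc [symmetric])
        moreover have "norm (pos (\<gamma> *v z x) - pos (\<gamma> *v einf)) \<le> A3 / h"
          using I(2)[OF x(1)] gl(8)[OF x(1)] by (simp add: f_def)
        moreover have "A1 * exp t * h \<le> (\<gamma> *v z x) $ Some None" "(\<gamma> *v z x) $ Some None \<le> A2 * exp t * h"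
          unfolding I(1)[OF x(1)] by (rule gl(5,6)[OF x(1)])+
        ultimately show "b \<in> ?S"
          using fpos[OF x(1)] by (intro CollectI exI[of _ ?g]) (auto simp: x(2) f_def)
      qed
    qed
  qed
  moreover have "T > 0" by (simp add: T_def less_max_iff_disj)
  moreover have "\<Upsilon> > 0" using delta kap by (simp add: \<Upsilon>_def)
  ultimately show ?thesis by blast
qed

end

section \<open>From light-cone vectors back to heights and boundary points\<close>

theorem theorem4p1:
  fixes \<Gamma> :: "'m::finite gmat set"
    and s0 :: real and eta0 :: "'m gmat set" and \<Xi> :: "'m gmat set"
    and c :: "real^'m" and \<rho> :: real
  assumes Gamma_sub: "is_subgroup \<Gamma> Gset"
    and Gamma_discrete: "discrete_set \<Gamma>"
    and noncompact: "\<not> (\<exists>C. compact C \<and> C \<subseteq> Gset \<and> Gset = setmul \<Gamma> C)"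
    and s0_pos: "s0 > 0"
    and eta0: "compact eta0" "eta0 \<subseteq> Nset"
    and Xi: "finite \<Xi>" "\<Xi> \<subseteq> Gset" "mat 1 \<in> \<Xi>"
    and cond_i: "Gset = setmul \<Gamma> (setmul \<Xi> (Omega eta0 s0))"
    and cond_ii: "\<forall>\<xi>\<in>\<Xi>. cocompact_lattice (\<Gamma> \<inter> conjN \<xi>) (conjN \<xi>)"
    and cond_iii: "\<forall>eta. compact eta \<and> eta \<subseteq> Nset \<longrightarrow>
        finite {\<gamma> \<in> \<Gamma>. setmul {\<gamma>} (setmul \<Xi> (Omega eta s0)) \<inter> Omega eta s0 \<noteq> {}}"
    and cond_iv: "\<forall>eta. compact eta \<and> eta \<subseteq> Nset \<and> eta0 \<subseteq> eta \<longrightarrow>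
        (\<exists>s1>s0. \<forall>\<gamma>\<in>\<Gamma>. \<forall>\<xi>1\<in>\<Xi>. \<forall>\<xi>2\<in>\<Xi>.
           setmul {\<gamma> ** \<xi>1} (Omega eta s0) \<inter> setmul {\<xi>2} (Omega eta s1) \<noteq> {} \<longrightarrow>
           \<xi>1 = \<xi>2 \<and> \<gamma> \<in> conjNM \<xi>1)"
    and ball: "\<rho> > 0"
  shows "\<forall>A1 A2 A3::real. 0 < A1 \<and> A1 < A2 \<and> 0 < A3 \<longrightarrow>
     (\<exists>T>0. \<exists>h0>0. \<exists>\<Upsilon>>0. \<forall>t\<ge>T. \<forall>\<gamma>\<in>\<Gamma>.
        \<gamma> \<notin> Pset \<and> bdry \<gamma> \<in> cball c \<rho> \<and> height \<gamma> \<ge> h0 \<longrightarrow>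
        (let S = {bdry \<gamma>' | \<gamma>'. \<gamma>' \<in> \<Gamma> \<and> \<gamma>' \<notin> Pset \<and>
                    A1 * exp t * height \<gamma> \<le> height \<gamma>' \<and>
                    height \<gamma>' \<le> A2 * exp t * height \<gamma> \<and>
                    norm (bdry \<gamma>' - bdry \<gamma>) \<le> A3 / height \<gamma>}
         in infinite S \<or> \<Upsilon> * exp (real CARD('m) * t) \<le> real (card S)))"
proof (intro allI impI)
  interpret cusp_data \<Gamma> \<Xi> s0 eta0
    using Gamma_sub Gamma_discrete s0_pos eta0(2) Xi cond_i cond_ii by unfold_locales
  fix A1 A2 A3 :: real
  assume A: "0 < A1 \<and> A1 < A2 \<and> 0 < A3"
  then obtain T \<Upsilon> where T: "T > 0" and Ups: "\<Upsilon> > 0" and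
    main: "\<And>t \<gamma>. t \<ge> T \<Longrightarrow> \<gamma> \<in> \<Gamma> \<Longrightarrow> (\<gamma> *v einf) $ Some None > 0 \<Longrightarrow>
      at_least {pos (\<gamma>' *v einf) | \<gamma>'. \<gamma>' \<in> \<Gamma> \<and> (\<gamma>' *v einf) $ Some None > 0 \<and>
        A1 * exp t * (\<gamma> *v einf) $ Some None \<le> (\<gamma>' *v einf) $ Some None \<and>
        (\<gamma>' *v einf) $ Some None \<le> A2 * exp t * (\<gamma> *v einf) $ Some None \<and>
        norm (pos (\<gamma>' *v einf) - pos (\<gamma> *v einf)) \<le> A3 / (\<gamma> *v einf) $ Some None}
      (\<Upsilon> * exp (real CARD('m) * t))"
    using count_near_cusp[of A1 A2 A3] by blast
  have coords: "(g *v einf) $ Some None > 0 \<and> height g = (g *v einf) $ Some None \<and> bdry g = pos (g *v einf)"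
    if "g \<in> \<Gamma>" "g \<notin> Pset" for g
    using that Gset_height_pos_iff height_bdry Gamma_Gset by metis
  have notP: "g \<notin> Pset" if "g \<in> \<Gamma>" "(g *v einf) $ Some None > 0" for g
    using that Gset_height_pos_iff Gamma_Gset by metis
  have "at_least {bdry \<gamma>' | \<gamma>'. \<gamma>' \<in> \<Gamma> \<and> \<gamma>' \<notin> Pset \<and>
                    A1 * exp t * height \<gamma> \<le> height \<gamma>' \<and>
                    height \<gamma>' \<le> A2 * exp t * height \<gamma> \<and>
                    norm (bdry \<gamma>' - bdry \<gamma>) \<le> A3 / height \<gamma>} (\<Upsilon> * exp (real CARD('m) * t))"
    if t: "t \<ge> T" and g: "\<gamma> \<in> \<Gamma>" "\<gamma> \<notin> Pset" for t \<gamma>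
  proof (rule at_least_mono[OF main[OF t g(1)] _ order_refl])
    note G = coords[OF g]
    show "(\<gamma> *v einf) $ Some None > 0" using G by blast
    show "{pos (\<gamma>' *v einf) | \<gamma>'. \<gamma>' \<in> \<Gamma> \<and> (\<gamma>' *v einf) $ Some None > 0 \<and>
        A1 * exp t * (\<gamma> *v einf) $ Some None \<le> (\<gamma>' *v einf) $ Some None \<and>
        (\<gamma>' *v einf) $ Some None \<le> A2 * exp t * (\<gamma> *v einf) $ Some None \<and>
        norm (pos (\<gamma>' *v einf) - pos (\<gamma> *v einf)) \<le> A3 / (\<gamma> *v einf) $ Some None}
      \<subseteq> {bdry \<gamma>' | \<gamma>'. \<gamma>' \<in> \<Gamma> \<and> \<gamma>' \<notin> Pset \<and>
                    A1 * exp t * height \<gamma> \<le> height \<gamma>' \<and>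
                    height \<gamma>' \<le> A2 * exp t * height \<gamma> \<and>
                    norm (bdry \<gamma>' - bdry \<gamma>) \<le> A3 / height \<gamma>}"
    proof clarify
      fix g assume a: "g \<in> \<Gamma>" "(g *v einf) $ Some None > 0"
        "A1 * exp t * (\<gamma> *v einf) $ Some None \<le> (g *v einf) $ Some None"
        "(g *v einf) $ Some None \<le> A2 * exp t * (\<gamma> *v einf) $ Some None"
        "norm (pos (g *v einf) - pos (\<gamma> *v einf)) \<le> A3 / (\<gamma> *v einf) $ Some None"
      have "g \<notin> Pset" by (rule notP[OF a(1,2)])
      then show "\<exists>\<gamma>'. pos (g *v einf) = bdry \<gamma>' \<and> \<gamma>' \<in> \<Gamma> \<and> \<gamma>' \<notin> Pset \<and>
                    A1 * exp t * height \<gamma> \<le> height \<gamma>' \<and>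
                    height \<gamma>' \<le> A2 * exp t * height \<gamma> \<and>
                    norm (bdry \<gamma>' - bdry \<gamma>) \<le> A3 / height \<gamma>"
        using coords[OF a(1)] a G by (intro exI[of _ g]) simp
    qed
  qed
  then show "\<exists>T>0. \<exists>h0>0. \<exists>\<Upsilon>>0. \<forall>t\<ge>T. \<forall>\<gamma>\<in>\<Gamma>.
        \<gamma> \<notin> Pset \<and> bdry \<gamma> \<in> cball c \<rho> \<and> height \<gamma> \<ge> h0 \<longrightarrow>
        (let S = {bdry \<gamma>' | \<gamma>'. \<gamma>' \<in> \<Gamma> \<and> \<gamma>' \<notin> Pset \<and>
                    A1 * exp t * height \<gamma> \<le> height \<gamma>' \<and>
                    height \<gamma>' \<le> A2 * exp t * height \<gamma> \<and>
                    norm (bdry \<gamma>' - bdry \<gamma>) \<le> A3 / height \<gamma>}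
         in infinite S \<or> \<Upsilon> * exp (real CARD('m) * t) \<le> real (card S))"
    unfolding Let_def at_least_def [symmetric]
    using T Ups by (intro exI[of _ T] exI[of _ "1::real"] exI[of _ \<Upsilon>] conjI allI ballI impI) simp_all
qed

end
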